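(* Let $n$ be a positive natural number. If there is a strongly homogeneous Souslin tree, then there is a Souslin tree which is $n$-free but not $(n+1)$-free.
   Context: A tree is a partial order $(T,<_T)$ in which the set of predecessors of every node $t$ is well-ordered by $<_T$; its order type is the height $\mathrm{ht}(t)$ of $t$. $T_\alpha$ is the set of nodes of height $\alpha$, and the height of $T$ is the least $\alpha$ with $T_\alpha=\emptyset$. For $t\in T$, $T(t)=\{s\in T: t\le_T s\}$ with the inherited order. $T$ is $\aleph_0$-splitting if every node that is not a leaf has exactly $\aleph_0$ immediate successors. $T$ is normal if: (a) there is a single minimal node (the root); (b) each node $s$ with $\mathrm{ht}(s)+1<\mathrm{ht}\,T$ has at least two immediate successors; (c) each node has successors in every higher non-empty level; (d) nodes of the same limit height with the same set of predecessors are equal. An antichain is a set of pairwise incomparable nodes; $T$ satisfies the c.c.c. if all its antichains are countable. A branch is a linearly ordered, downward closed subset. A Souslin tree is a tree of height $\omega_1$ all of whose antichains and all of whose branches are countable. Convention: all Souslin trees are assumed normal and $\aleph_0$-splitting. For trees $T^i$ ($i\in I$) of the same height $\mu$, the tree product is $\bigotimes_{i\in I}T^i=\bigcup_{\alpha<\mu}\prod_{i\in I}T^i_\alpha$ with the coordinatewise tree order. A Souslin tree $T$ is strongly homogeneous if there is a family $(\psi_{st}\mid s,t\in T,\ \mathrm{ht}(s)=\mathrm{ht}(t))$ (a coherent family) such that: (1) $\psi_{st}:T(s)\to T(t)$ is a tree isomorphism and $\psi_{ss}$ is the identity; (2) $\psi_{rt}=\psi_{st}\circ\psi_{rs}$ for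 all $r,s,t$ of the same level; (3) if $r,s$ are on the same level, $t$ is above $r$ and $u=\psi_{rs}(t)$, then $\psi_{tu}$ is the restriction of $\psi_{rs}$ to $T(t)$; (4) if $t,u$ are on the same limit level $T_\alpha$, then there is $\gamma<\alpha$ such that for the predecessors $r$ of $t$ and $s$ of $u$ on level $T_\gamma$ we have $\psi_{rs}(t)=u$. For a positive natural number $n$, a Souslin tree $T$ is $n$-free if for every subset $P$ of size $n$ of some level $T_\alpha$, $\alpha<\omega_1$, the tree product $\bigotimes_{s\in P}T(s)$ satisfies the c.c.c. *)

theory Defs
  imports Main "HOL-Library.Countable_Set" "HOL-Library.FuncSet"
begin

unbundle cardinal_syntax

text \<open>
  A tree is given by its reflexive order relation \<open>T\<close>, so that its set of nodes is \<open>Field T\<close>.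
  Ordinals are represented by (reflexive) well-order relations, compared by \<open>=o\<close> and \<open><o\<close>.
\<close>

definition tree :: "'a rel \<Rightarrow> bool" where
  "tree T \<longleftrightarrow> Partial_order T \<and> (\<forall>t\<in>Field T. Well_order (Restr T (underS T t)))"

definition ht :: "'a rel \<Rightarrow> 'a \<Rightarrow> 'a rel" where
  "ht T t = Restr T (underS T t)"

text \<open>
  The order type of the predecessors of \<open>t\<close> together with \<open>t\<close> itself, that is, \<open>ht(t) + 1\<close>.
\<close>

definition ht_plus_one :: "'a rel \<Rightarrow> 'a \<Rightarrow> 'a rel" where
  "ht_plus_one T t = Restr T (under T t)"

definition level :: "'a rel \<Rightarrow> 'b rel \<Rightarrow> 'a set" where
  "level T \<alpha> = {t \<in> Field T. ht T t =o \<alpha>}"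

text \<open>
  Every ordinal below \<open>\<mu>\<close> is the order type of a proper initial segment of \<open>\<mu>\<close>; hence it is
  enough to let \<open>\<alpha>\<close> range over relations on the same type as \<open>\<mu>\<close>, here and below.
\<close>

definition has_height :: "'a rel \<Rightarrow> 'b rel \<Rightarrow> bool" where
  "has_height T \<mu> \<longleftrightarrow>
     Well_order \<mu> \<and> level T \<mu> = {} \<and> (\<forall>\<alpha> :: 'b rel. \<alpha> <o \<mu> \<longrightarrow> level T \<alpha> \<noteq> {})"

definition limit_ordinal :: "'a rel \<Rightarrow> bool" where
  "limit_ordinal \<alpha> \<longleftrightarrow>
     Well_order \<alpha> \<and> Field \<alpha> \<noteq> {} \<and> (\<forall>x\<in>Field \<alpha>. aboveS \<alpha> x \<noteq> {})"

definition omega1 :: "nat set rel" where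
  "omega1 = cardSuc natLeq"

definition subtree :: "'a rel \<Rightarrow> 'a \<Rightarrow> 'a rel" where
  "subtree T t = Restr T (above T t)"

definition immediate_successors :: "'a rel \<Rightarrow> 'a \<Rightarrow> 'a set" where
  "immediate_successors T t = {s \<in> aboveS T t. aboveS T t \<inter> underS T s = {}}"

definition aleph0_splitting :: "'a rel \<Rightarrow> bool" where
  "aleph0_splitting T \<longleftrightarrow>
     (\<forall>t\<in>Field T. aboveS T t \<noteq> {} \<longrightarrow> |immediate_successors T t| =o natLeq)"

text \<open>
  The parameter \<open>\<mu>\<close> is the height of \<open>T\<close>. In the third clause, the non-empty levels are
  written as the levels of nodes.
\<close>

definition normal_tree :: "'b rel \<Rightarrow> 'a rel \<Rightarrow> bool" where
  "normal_tree \<mu> T \<longleftrightarrow>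
     (\<exists>!t. t \<in> Field T \<and> underS T t = {}) \<and>
     (\<forall>s\<in>Field T. ht_plus_one T s <o \<mu> \<longrightarrow>
        (\<exists>u\<in>immediate_successors T s. \<exists>v\<in>immediate_successors T s. u \<noteq> v)) \<and>
     (\<forall>s\<in>Field T. \<forall>t\<in>Field T. ht T s <o ht T t \<longrightarrow>
        (\<exists>u\<in>level T (ht T t). u \<in> aboveS T s)) \<and>
     (\<forall>s\<in>Field T. \<forall>t\<in>Field T.
        limit_ordinal (ht T s) \<and> ht T s =o ht T t \<and> underS T s = underS T t \<longrightarrow> s = t)"

definition antichain :: "'a rel \<Rightarrow> 'a set \<Rightarrow> bool" where
  "antichain T A \<longleftrightarrow>
     A \<subseteq> Field T \<and> (\<forall>x\<in>A. \<forall>y\<in>A. x \<noteq> y \<longrightarrow> (x, y) \<notin> T \<and> (y, x) \<notin> T)"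

definition ccc :: "'a rel \<Rightarrow> bool" where
  "ccc T \<longleftrightarrow> (\<forall>A. antichain T A \<longrightarrow> countable A)"

definition branch :: "'a rel \<Rightarrow> 'a set \<Rightarrow> bool" where
  "branch T B \<longleftrightarrow> B \<in> Chains T \<and> Order_Relation.ofilter T B"

definition souslin_tree :: "'a rel \<Rightarrow> bool" where
  "souslin_tree T \<longleftrightarrow>
     tree T \<and> has_height T omega1 \<and> ccc T \<and> (\<forall>B. branch T B \<longrightarrow> countable B) \<and>
     normal_tree omega1 T \<and> aleph0_splitting T"

text \<open>
  The tree product of a family of trees of common height \<open>\<mu>\<close>.
\<close>

definition tree_product_nodes :: "'c rel \<Rightarrow> 'i set \<Rightarrow> ('i \<Rightarrow> 'a rel) \<Rightarrow> ('i \<Rightarrow> 'a) set" where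
  "tree_product_nodes \<mu> I T = (\<Union>\<alpha>\<in>{\<alpha> :: 'c rel. \<alpha> <o \<mu>}. \<Pi>\<^sub>E i\<in>I. level (T i) \<alpha>)"

definition tree_product :: "'c rel \<Rightarrow> 'i set \<Rightarrow> ('i \<Rightarrow> 'a rel) \<Rightarrow> ('i \<Rightarrow> 'a) rel" where
  "tree_product \<mu> I T =
     {(x, y). x \<in> tree_product_nodes \<mu> I T \<and> y \<in> tree_product_nodes \<mu> I T \<and>
              (\<forall>i\<in>I. (x i, y i) \<in> T i)}"

text \<open>
  For trees, \<open>iso\<close> means isomorphism of partial orders (lemma \<open>iso_iff2\<close>). Only the values of
  \<open>\<psi> s t\<close> on the nodes above \<open>s\<close>, for \<open>s\<close> and \<open>t\<close> of the same height, are relevant.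
\<close>

definition coherent_family :: "'a rel \<Rightarrow> ('a \<Rightarrow> 'a \<Rightarrow> 'a \<Rightarrow> 'a) \<Rightarrow> bool" where
  "coherent_family T \<psi> \<longleftrightarrow>
     (\<forall>s\<in>Field T. \<forall>t\<in>Field T. ht T s =o ht T t \<longrightarrow> iso (subtree T s) (subtree T t) (\<psi> s t)) \<and>
     (\<forall>s\<in>Field T. \<forall>x\<in>above T s. \<psi> s s x = x) \<and>
     (\<forall>r\<in>Field T. \<forall>s\<in>Field T. \<forall>t\<in>Field T. ht T r =o ht T s \<and> ht T s =o ht T t \<longrightarrow>
        (\<forall>x\<in>above T r. \<psi> r t x = \<psi> s t (\<psi> r s x))) \<and>
     (\<forall>r\<in>Field T. \<forall>s\<in>Field T. ht T r =o ht T s \<longrightarrow>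
        (\<forall>t\<in>above T r. \<forall>x\<in>above T t. \<psi> t (\<psi> r s t) x = \<psi> r s x)) \<and>
     (\<forall>t\<in>Field T. \<forall>u\<in>Field T. ht T t =o ht T u \<and> limit_ordinal (ht T t) \<longrightarrow>
        (\<exists>\<gamma> :: 'a rel. \<gamma> <o ht T t \<and>
           (\<forall>r\<in>level T \<gamma> \<inter> underS T t. \<forall>s\<in>level T \<gamma> \<inter> underS T u. \<psi> r s t = u)))"

definition strongly_homogeneous :: "'a rel \<Rightarrow> bool" where
  "strongly_homogeneous T \<longleftrightarrow> (\<exists>\<psi>. coherent_family T \<psi>)"

definition n_free :: "nat \<Rightarrow> 'a rel \<Rightarrow> bool" where
  "n_free n T \<longleftrightarrow>
     (\<forall>(\<alpha> :: nat set rel) P. \<alpha> <o omega1 \<and> P \<subseteq> level T \<alpha> \<and> finite P \<and> card P = n \<longrightarrow>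
        ccc (tree_product omega1 P (subtree T)))"

end

theory Submission
  imports Defs "HOL-Library.Countable_Set_Type"
begin

text \<open>
  Let \<open>S\<close> be a strongly homogeneous Souslin tree. The idea is to read a node of \<open>S\<close> as a list of
  instructions that guides walks through another tree \<open>T\<close>, in such a way that one node of \<open>S\<close>
  can prescribe the walks from any \<open>n\<close> given nodes of a level of \<open>T\<close> freely, but never from
  \<open>n + 1\<close> of them.

  In detail, the children of every node of \<open>S\<close> are labelled by finite tables: at level \<open>a\<close> a
  label is a list of at most \<open>n\<close> pairs, each consisting of a node of level \<open>a\<close> and a number, and
  it stands for the function that has these values and is \<open>0\<close> everywhere else. Since levels are
  countable and splitting is infinite, every label can be made to occur below every node, and the
  isomorphisms \<open>\<psi>\<close> of the coherent family make it possible to do this in a \<open>\<psi>\<close>-invariant way. A walker who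
  stands on level \<open>a\<close> at the node \<open>t\<close> of \<open>T\<close> and is guided by the node \<open>x\<close> of \<open>S\<close> moves to the
  child of \<open>t\<close> whose number is the value at \<open>t\<close> of the label of \<open>x\<close> on level \<open>a\<close>. Two nodes
  of \<open>S\<close> are identified if they guide the walk from the root in the same way, and \<open>T\<close> is the tree
  of equivalence classes. It is represented inside \<open>S\<close> by choosing one node \<open>rep x\<close> in each class,
  with unchanged levels; the labels speak about representatives, so that \<open>rep\<close> is defined by
  recursion on the level.

  An antichain of \<open>T\<close> is an antichain of \<open>S\<close>, which gives the countable chain condition and,
  as \<open>T\<close> splits, the countability of branches. A node of \<open>T\<close> has infinitely many children since every
  number occurs as a move (\<open>souslin_T\<close>).

  The heart of the proof is the lemma \<open>ex_common_guide\<close>: given at most \<open>n\<close> nodes of \<open>T\<close> on a level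
  \<open>b\<close> whose restrictions to a level \<open>a\<close> are distinct, and any node \<open>s\<^sub>0\<close> of \<open>S\<close> on level \<open>a\<close>, some
  node of \<open>S\<close> above \<open>s\<^sub>0\<close> guides all of their walks from \<open>a\<close> to \<open>b\<close>. At successors this holds since
  a table with \<open>n\<close> entries can have any values at \<open>n\<close> places. At a limit level, coherence says that
  any two nodes of \<open>S\<close> on it have the same labels from some earlier level on; hence all the given nodes
  are guided by one and the same node from some level on, and the isomorphisms \<open>\<psi>\<close> graft this common
  end onto the guide found up to there. Sending an element of the product of \<open>n\<close> subtrees to such a
  guide maps antichains injectively to antichains of \<open>S\<close>, so \<open>T\<close> is \<open>n\<close>-free (\<open>n_free_T\<close>).

  For \<open>n + 1\<close> children of the root, walk for each level \<open>d\<close> under a common guide up to \<open>d\<close> and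
  then let each of the \<open>n + 1\<close> walkers make the move \<open>1\<close>. No label permits this last move to all of
  them at once, hence no such tuple is extended by another one, and together they form an
  uncountable antichain (\<open>not_Suc_n_free_T\<close>).
\<close>

section \<open>Countable ordinals\<close>

lemma natLeq_less_omega1: "natLeq <o omega1"
  unfolding omega1_def by (rule cardSuc_greater[OF natLeq_Card_order])

lemma Card_order_omega1: "Card_order omega1"
  unfolding omega1_def by (rule cardSuc_Card_order[OF natLeq_Card_order])

lemma Well_order_omega1: "Well_order omega1"
  using Card_order_omega1 by (rule card_order_on_well_order_on)

lemma Field_omega1_nonempty: "Field omega1 \<noteq> {}"
proof
  assume "Field omega1 = {}"
  moreover have "|Field natLeq| \<le>o |Field omega1|"
    using natLeq_less_omega1 ordLess_imp_ordLeq card_of_mono2 by blast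
  ultimately show False
    by (simp add: Field_natLeq flip: card_of_ordLeq)
qed

text \<open>
  The countable ordinals as a type of class \<open>wellorder\<close>: heights become elements of a linearly
  ordered type and are compared by equality instead of order isomorphism.
\<close>

typedef ord1 = "Field omega1"
  morphisms rep_ord1 abs_ord1
  using Field_omega1_nonempty by blast

instantiation ord1 :: wellorder
begin

definition less_eq_ord1 :: "ord1 \<Rightarrow> ord1 \<Rightarrow> bool" where
  "a \<le> b \<longleftrightarrow> (rep_ord1 a, rep_ord1 b) \<in> omega1"

definition less_ord1 :: "ord1 \<Rightarrow> ord1 \<Rightarrow> bool" where
  "a < b \<longleftrightarrow> (rep_ord1 a, rep_ord1 b) \<in> omega1 - Id"

instance
proof
  have refl: "\<And>x. x \<in> Field omega1 \<Longrightarrow> (x, x) \<in> omega1"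
    and trans: "trans omega1" and antisym: "antisym omega1"
    and total: "Total omega1" and wf: "wf (omega1 - Id)"
    using Well_order_omega1
    by (auto simp: well_order_on_def linear_order_on_def partial_order_on_def preorder_on_def
        refl_on_def)
  fix x y z :: ord1
  show "x < y \<longleftrightarrow> x \<le> y \<and> \<not> y \<le> x"
    using antisym by (auto simp: less_eq_ord1_def less_ord1_def rep_ord1_inject
        intro: refl rep_ord1 dest: antisymD)
  show "x \<le> x" by (auto simp: less_eq_ord1_def intro: refl rep_ord1)
  show "x \<le> y \<Longrightarrow> y \<le> z \<Longrightarrow> x \<le> z"
    using trans by (auto simp: less_eq_ord1_def dest: transD)
  show "x \<le> y \<Longrightarrow> y \<le> x \<Longrightarrow> x = y"
    using antisym by (auto simp: less_eq_ord1_def rep_ord1_inject dest: antisymD)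
  show "x \<le> y \<or> y \<le> x"
    using total refl rep_ord1[of x] rep_ord1[of y] by (auto simp: less_eq_ord1_def total_on_def) metis
  fix P :: "ord1 \<Rightarrow> bool"
  assume step: "\<And>x. (\<And>y. y < x \<Longrightarrow> P y) \<Longrightarrow> P x"
  have "wf (inv_image (omega1 - Id) rep_ord1)" using wf by (rule wf_inv_image)
  then show "P x"
    by (induction x rule: wf_induct_rule) (auto intro: step simp: less_ord1_def)
qed

end

lemma ordIso_cong:
  assumes "r =o r'" "s =o s'"
  shows "r =o s \<longleftrightarrow> r' =o s'"
  using ordIso_transitive[OF ordIso_transitive[OF ordIso_symmetric[OF assms(1)]] assms(2)]
    ordIso_transitive[OF ordIso_transitive[OF assms(1)] ordIso_symmetric[OF assms(2)]]
  by (rule iffI)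

lemma ordLess_cong:
  assumes "r =o r'" "s =o s'"
  shows "r <o s \<longleftrightarrow> r' <o s'"
  using ordLess_ordIso_trans[OF ordIso_ordLess_trans[OF ordIso_symmetric[OF assms(1)]] assms(2)]
    ordLess_ordIso_trans[OF ordIso_ordLess_trans[OF assms(1)] ordIso_symmetric[OF assms(2)]]
  by (rule iffI)

definition ord_on :: "ord1 set \<Rightarrow> ord1 rel" where
  "ord_on B = {(a, b). a \<in> B \<and> b \<in> B \<and> a \<le> b}"

lemma Field_ord_on [simp]: "Field (ord_on B) = B"
  by (auto simp: ord_on_def Field_def)

lemma Well_order_ord_on: "Well_order (ord_on B)"
proof -
  have "wf (ord_on B - Id)"
    by (rule wf_subset[OF wf]) (auto simp: ord_on_def less_le)
  then show ?thesis
    unfolding well_order_on_def linear_order_on_def partial_order_on_def preorder_on_def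
      Field_ord_on
    by (auto simp: refl_on_def trans_def antisym_def total_on_def ord_on_def)
qed

lemma ord_on_UNIV: "ord_on UNIV =o omega1"
proof -
  have "dir_image (ord_on UNIV) rep_ord1 = omega1"
  proof (rule subset_antisym; rule subrelI)
    fix x y assume "(x, y) \<in> omega1"
    moreover then have "x \<in> Field omega1" "y \<in> Field omega1" by (auto simp: Field_def)
    ultimately show "(x, y) \<in> dir_image (ord_on UNIV) rep_ord1"
      unfolding dir_image_def ord_on_def less_eq_ord1_def
      by (simp, metis abs_ord1_inverse)
  qed (auto simp: dir_image_def ord_on_def less_eq_ord1_def)
  then show ?thesis
    using dir_image_ordIso[OF Well_order_ord_on, of rep_ord1 UNIV]
    by (auto simp: inj_on_def rep_ord1_inject)
qed

lemma ord_on_initial_segment_less: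
  assumes "A \<subset> B" "\<And>x y. y \<in> A \<Longrightarrow> x \<in> B \<Longrightarrow> x \<le> y \<Longrightarrow> x \<in> A"
  shows "ord_on A <o ord_on B"
proof -
  have "Order_Relation.ofilter (ord_on B) A"
    using assms unfolding ofilter_def Field_ord_on by (auto simp: under_def ord_on_def)
  then have "Restr (ord_on B) A <o ord_on B"
    using ofilter_ordLess[OF Well_order_ord_on] assms(1) by auto
  moreover have "Restr (ord_on B) A = ord_on A" using assms(1) by (auto simp: ord_on_def)
  ultimately show ?thesis by simp
qed

text \<open>
  Heights in the subtree above a node of level \<open>a\<close> are order types of such intervals; this lemma
  recovers the level in the whole tree from the height in the subtree.
\<close>

lemma ord_on_interval_inject:
  assumes "ord_on {a..<b} =o ord_on {a..<c}" "a \<le> b" "a \<le> c"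
  shows "b = c"
proof (rule ccontr)
  have less: "ord_on {a..<u} <o ord_on {a..<v}" if "a \<le> u" "u < v" for u v
    using that by (intro ord_on_initial_segment_less) auto
  assume "b \<noteq> c"
  then have "b < c \<or> c < b" by auto
  then show False
    using less assms not_ordLess_ordIso ordIso_symmetric by blast
qed

lemma ord_on_less_mono: "a < b \<Longrightarrow> ord_on {..<a} <o ord_on {..<b}"
  by (intro ord_on_initial_segment_less) auto

lemma ord_on_lessThan_inject: "ord_on {..<a} =o ord_on {..<b} \<longleftrightarrow> a = b"
  using ord_on_less_mono not_ordLess_ordIso ordIso_symmetric ordIso_reflexive Well_order_ord_on
  by (metis neqE)

lemma ord_on_lessThan_less: "ord_on {..<a} <o ord_on {..<b} \<longleftrightarrow> a < b"
  using ord_on_less_mono ordLess_irreflexive ordLess_transitive by (metis neqE)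

lemma less_ord_on_iff:
  assumes "\<And>x y. y \<in> B \<Longrightarrow> x \<le> y \<Longrightarrow> x \<in> B"
  shows "\<alpha> <o ord_on B \<longleftrightarrow> (\<exists>a\<in>B. \<alpha> =o ord_on {..<a})"
proof
  assume "\<alpha> <o ord_on B"
  moreover then have "Well_order \<alpha>" by (simp add: ordLess_def)
  ultimately obtain a where a: "a \<in> B" "\<alpha> =o Restr (ord_on B) (underS (ord_on B) a)"
    using ordLess_iff_ordIso_Restr[OF Well_order_ord_on, of \<alpha>] by auto
  have "Restr (ord_on B) (underS (ord_on B) a) = ord_on {..<a}"
    using a(1) assms by (auto simp: ord_on_def underS_def)
  then show "\<exists>a\<in>B. \<alpha> =o ord_on {..<a}" using a by auto
next
  assume "\<exists>a\<in>B. \<alpha> =o ord_on {..<a}"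
  then obtain a where a: "a \<in> B" "\<alpha> =o ord_on {..<a}" by auto
  have "ord_on {..<a} <o ord_on B"
    using a(1) assms by (intro ord_on_initial_segment_less) (auto intro: less_imp_le)
  then show "\<alpha> <o ord_on B" using a(2) ordIso_ordLess_trans by blast
qed

lemma less_omega1_iff: "\<alpha> <o omega1 \<longleftrightarrow> (\<exists>a. \<alpha> =o ord_on {..<a})"
proof -
  have "Well_order \<alpha> \<Longrightarrow> \<alpha> <o omega1 \<longleftrightarrow> \<alpha> <o ord_on UNIV"
    using ordLess_cong[OF ordIso_reflexive[of \<alpha>] ord_on_UNIV] by simp
  then have "\<alpha> <o omega1 \<longleftrightarrow> \<alpha> <o ord_on UNIV" by (auto simp: ordLess_def)
  then show ?thesis using less_ord_on_iff[of UNIV \<alpha>] by simp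
qed

lemma countable_less_omega1:
  assumes "Well_order r" "countable (Field r)"
  shows "r <o omega1"
proof (rule ccontr)
  assume "\<not> r <o omega1"
  then have "omega1 \<le>o r" using assms Well_order_omega1 not_ordLess_iff_ordLeq by blast
  then have "|Field omega1| \<le>o |Field r|" by (rule card_of_mono2)
  moreover have "|Field r| \<le>o natLeq"
    using assms(2) by (simp add: countable_card_le_natLeq)
  ultimately have "omega1 \<le>o natLeq"
    using card_of_Field_ordIso[OF Card_order_omega1] ordIso_ordLeq_trans ordIso_symmetric
      ordLeq_transitive by blast
  then show False using natLeq_less_omega1 not_ordLess_ordLeq by blast
qed

lemma countable_lessThan_ord1: "countable {..<a :: ord1}"
proof -
  have "ord_on {..<a} <o omega1"
    using less_omega1_iff ordIso_reflexive Well_order_ord_on by blast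
  then have "|Field (ord_on {..<a})| <o omega1"
    using card_of_least[of "Field (ord_on {..<a})" "ord_on {..<a}"] Well_order_ord_on
      ordLeq_ordLess_trans by blast
  then have "|{..<a}| \<le>o natLeq"
    using cardSuc_ordLeq_ordLess[OF natLeq_Card_order card_of_Card_order, of "{..<a}"]
    unfolding omega1_def by simp
  then show ?thesis by (simp add: countable_card_le_natLeq)
qed

lemma uncountable_ord1: "uncountable (UNIV :: ord1 set)"
  using countable_less_omega1[OF Well_order_ord_on, of UNIV] ord_on_UNIV not_ordLess_ordIso by auto

lemma ord1_no_max: "\<exists>b > a :: ord1. True"
proof (rule ccontr)
  assume "\<not> ?thesis"
  then have "UNIV = insert a {..<a}" using linorder_less_linear by blast
  then show False using uncountable_ord1 countable_lessThan_ord1 by (metis countable_insert)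
qed

definition osuc :: "ord1 \<Rightarrow> ord1" where
  "osuc a = (LEAST b. a < b)"

lemma less_osuc_iff: "a < osuc b \<longleftrightarrow> a \<le> b"
  unfolding osuc_def using ord1_no_max[of b] by (metis (no_types, lifting) LeastI le_less_trans not_le not_less_Least)

lemma osuc_le_iff: "osuc a \<le> b \<longleftrightarrow> a < b"
  using less_osuc_iff by (metis not_le)

lemma less_osuc [simp]: "a < osuc a"
  by (simp add: less_osuc_iff)

lemma le_osuc [simp]: "a \<le> osuc a"
  by (simp add: less_imp_le)

lemma osuc_inject [simp]: "osuc a = osuc b \<longleftrightarrow> a = b"
  by (metis less_osuc_iff less_osuc antisym_conv)

definition is_limit :: "ord1 \<Rightarrow> bool" where
  "is_limit a \<longleftrightarrow> (\<exists>b. b < a) \<and> (\<forall>b<a. \<exists>c. b < c \<and> c < a)"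

lemma less_or_limit_cases:
  assumes "a < b"
  obtains d where "b = osuc d" "a \<le> d" | "is_limit b"
  by (metis assms is_limit_def less_osuc_iff osuc_le_iff le_less not_less)

lemma ord_on_lessThan_less_omega1: "ord_on {..<a} <o omega1"
  using less_omega1_iff ordIso_reflexive[OF Well_order_ord_on] by blast

lemma ord_on_lessThan_ordIso_iff:
  assumes "r =o ord_on {..<a}" "s =o ord_on {..<b}"
  shows "r =o s \<longleftrightarrow> a = b"
  unfolding ordIso_cong[OF assms] by (rule ord_on_lessThan_inject)

lemma ord_on_lessThan_ordLess_iff:
  assumes "r =o ord_on {..<a}" "s =o ord_on {..<b}"
  shows "r <o s \<longleftrightarrow> a < b"
  unfolding ordLess_cong[OF assms] by (rule ord_on_lessThan_less)

section \<open>Trees with a level function\<close>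

text \<open>
  The trees of height \<open>\<omega>\<^sub>1\<close>, with the height of each node recorded as a countable ordinal. All notions
  that refer to order types of sets of predecessors are translated below into statements about
  \<open>lev\<close>; the function \<open>restr\<close> projects a node to the levels below it.
\<close>

locale leveled_tree =
  fixes S :: "'a rel" and lev :: "'a \<Rightarrow> ord1"
  assumes partial_order: "Partial_order S"
    and lev_less: "(x, y) \<in> S \<Longrightarrow> x \<noteq> y \<Longrightarrow> lev x < lev y"
    and ex_below: "y \<in> Field S \<Longrightarrow> a \<le> lev y \<Longrightarrow> \<exists>x. (x, y) \<in> S \<and> lev x = a"
    and below_unique: "(x, z) \<in> S \<Longrightarrow> (y, z) \<in> S \<Longrightarrow> lev x = lev y \<Longrightarrow> x = y"
    and level_nonempty: "\<exists>x\<in>Field S. lev x = a"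
begin

definition restr :: "'a \<Rightarrow> ord1 \<Rightarrow> 'a" where
  "restr x a = (THE y. (y, x) \<in> S \<and> lev y = a)"

definition children :: "'a \<Rightarrow> 'a set" where
  "children x = {y. (x, y) \<in> S \<and> lev y = osuc (lev x)}"

lemma refl [intro, simp]: "x \<in> Field S \<Longrightarrow> (x, x) \<in> S"
  using partial_order by (auto simp: partial_order_on_def preorder_on_def refl_on_def)

lemma trans: "(x, y) \<in> S \<Longrightarrow> (y, z) \<in> S \<Longrightarrow> (x, z) \<in> S"
  using partial_order by (auto simp: partial_order_on_def preorder_on_def dest: transD)

lemma Field1: "(x, y) \<in> S \<Longrightarrow> x \<in> Field S"
  and Field2: "(x, y) \<in> S \<Longrightarrow> y \<in> Field S"
  by (auto simp: Field_def)

lemma lev_le: "(x, y) \<in> S \<Longrightarrow> lev x \<le> lev y"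
  using lev_less by (cases "x = y") (auto intro: less_imp_le)

lemma
  assumes "x \<in> Field S" "a \<le> lev x"
  shows restr_below: "(restr x a, x) \<in> S" and lev_restr [simp]: "lev (restr x a) = a"
proof -
  have "\<exists>!y. (y, x) \<in> S \<and> lev y = a"
    using ex_below[OF assms] below_unique by blast
  then have "(restr x a, x) \<in> S \<and> lev (restr x a) = a"
    unfolding restr_def by (rule theI')
  then show "(restr x a, x) \<in> S" "lev (restr x a) = a" by auto
qed

lemma restr_in_Field: "x \<in> Field S \<Longrightarrow> a \<le> lev x \<Longrightarrow> restr x a \<in> Field S"
  using restr_below Field1 by blast

lemma restr_eq: "(y, x) \<in> S \<Longrightarrow> restr x (lev y) = y"
  using restr_below[of x "lev y"] lev_restr[of x "lev y"] lev_le Field2 below_unique by blast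

lemma restr_eqI: "(y, x) \<in> S \<Longrightarrow> lev y = a \<Longrightarrow> restr x a = y"
  using restr_eq by blast

lemma restr_self [simp]: "x \<in> Field S \<Longrightarrow> restr x (lev x) = x"
  by (simp add: restr_eq)

lemma restr_of_below:
  assumes "(y, x) \<in> S" "a \<le> lev y"
  shows "restr y a = restr x a"
proof -
  have y: "y \<in> Field S" using assms Field1 by blast
  have "(restr y a, x) \<in> S" using restr_below[OF y assms(2)] assms(1) trans by blast
  then show ?thesis using restr_eqI lev_restr[OF y assms(2)] by metis
qed

lemma restr_restr: "x \<in> Field S \<Longrightarrow> a \<le> b \<Longrightarrow> b \<le> lev x \<Longrightarrow> restr (restr x b) a = restr x a"
  using restr_of_below[OF restr_below, of x b a] by simp

lemma below_comparable:
  assumes "(x, z) \<in> S" "(y, z) \<in> S" "lev x \<le> lev y"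
  shows "(x, y) \<in> S"
  using restr_of_below[OF assms(2,3)] restr_eq[OF assms(1)] restr_below[OF Field1[OF assms(2)] assms(3)]
  by simp

lemma restr_mono: "x \<in> Field S \<Longrightarrow> a \<le> b \<Longrightarrow> b \<le> lev x \<Longrightarrow> (restr x a, restr x b) \<in> S"
  using restr_below[OF restr_in_Field, of x b a] by (simp add: restr_restr)

lemma restr_osuc_in_children:
  "x \<in> Field S \<Longrightarrow> a < lev x \<Longrightarrow> restr x (osuc a) \<in> children (restr x a)"
  using restr_mono[of x a "osuc a"] osuc_le_iff[of a "lev x"] by (auto simp: children_def)

text \<open>
  On a set of predecessors of one node \<open>lev\<close> is an order embedding, as predecessors are comparable
  and distinct ones lie on distinct levels. All order types needed below are instances of this.
\<close>

lemma chain_ordIso: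
  assumes "A \<subseteq> under S x"
  shows "Restr S A =o ord_on (lev ` A)"
proof -
  have A: "(y, x) \<in> S" if "y \<in> A" for y using assms that by (auto simp: under_def)
  have inj: "inj_on lev A" using A below_unique by (meson inj_onI)
  have "Restr S A = dir_image (ord_on (lev ` A)) (inv_into A lev)"
  proof (rule subset_antisym; rule subrelI)
    fix y z assume yz: "(y, z) \<in> Restr S A"
    then have "(lev y, lev z) \<in> ord_on (lev ` A)" using lev_le by (auto simp: ord_on_def)
    moreover have "y = inv_into A lev (lev y)" "z = inv_into A lev (lev z)"
      using yz inj by (auto simp: inv_into_f_f)
    ultimately show "(y, z) \<in> dir_image (ord_on (lev ` A)) (inv_into A lev)"
      unfolding dir_image_def by blast
  next
    fix y z assume "(y, z) \<in> dir_image (ord_on (lev ` A)) (inv_into A lev)"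
    then obtain u v where "u \<in> A" "v \<in> A" "lev u \<le> lev v"
      "y = inv_into A lev (lev u)" "z = inv_into A lev (lev v)"
      by (auto simp: dir_image_def ord_on_def)
    then show "(y, z) \<in> Restr S A"
      using inj below_comparable[OF A A] by (simp add: inv_into_f_f)
  qed
  moreover have "inj_on (inv_into A lev) (Field (ord_on (lev ` A)))"
    by (simp add: inj_on_inv_into)
  ultimately show ?thesis
    using dir_image_ordIso[OF Well_order_ord_on] ordIso_symmetric by metis
qed

lemma lev_image_underS:
  assumes "x \<in> Field S"
  shows "lev ` underS S x = {..<lev x}"
proof
  show "lev ` underS S x \<subseteq> {..<lev x}" using lev_less by (auto simp: underS_def)
  show "{..<lev x} \<subseteq> lev ` underS S x"
  proof
    fix a assume "a \<in> {..<lev x}"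
    then have "a < lev x" by simp
    then have r: "(restr x a, x) \<in> S" "lev (restr x a) = a"
      using assms restr_below lev_restr by (simp_all only: less_imp_le)
    moreover have "restr x a \<noteq> x" using r(2) \<open>a < lev x\<close> by (metis less_irrefl)
    ultimately have "restr x a \<in> underS S x" "lev (restr x a) = a"
      by (auto simp: underS_def)
    then show "a \<in> lev ` underS S x" by force
  qed
qed

lemma ht_ordIso: "x \<in> Field S \<Longrightarrow> ht S x =o ord_on {..<lev x}"
  using chain_ordIso[of "underS S x" x] lev_image_underS
  by (simp add: ht_def underS_subset_under)

lemma subtree_below_ordIso:
  assumes "(s, x) \<in> S"
  shows "ht (subtree S s) x =o ord_on {lev s..<lev x}"
proof -
  define A where "A = {y. (s, y) \<in> S \<and> (y, x) \<in> S \<and> y \<noteq> x}"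
  have "lev ` A = {lev s..<lev x}"
  proof
    show "lev ` A \<subseteq> {lev s..<lev x}" using lev_less lev_le by (auto simp: A_def)
    show "{lev s..<lev x} \<subseteq> lev ` A"
    proof
      fix a assume a: "a \<in> {lev s..<lev x}"
      have x: "x \<in> Field S" using assms Field2 by blast
      have le: "a \<le> lev x" using a by (simp add: less_imp_le)
      have r: "(restr x a, x) \<in> S" "lev (restr x a) = a"
        using restr_below[OF x le] lev_restr[OF x le] .
      moreover have "restr x a \<noteq> x" using r(2) a by (metis atLeastLessThan_iff less_irrefl)
      moreover have "(s, restr x a) \<in> S" using below_comparable[OF assms r(1)] r(2) a by simp
      ultimately have "restr x a \<in> A" "lev (restr x a) = a" by (auto simp: A_def)
      then show "a \<in> lev ` A" by force
    qed
  qed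
  moreover have "ht (subtree S s) x = Restr S A"
    using assms by (auto simp: ht_def subtree_def underS_def above_def A_def intro: trans)
  moreover have "A \<subseteq> under S x" by (auto simp: A_def under_def)
  ultimately show ?thesis using chain_ordIso[of A x] by simp
qed

lemma ht_ordIso_iff:
  assumes "x \<in> Field S" "y \<in> Field S"
  shows "ht S x =o ht S y \<longleftrightarrow> lev x = lev y"
  using ord_on_lessThan_ordIso_iff assms ht_ordIso by blast

lemma ht_ordLess_iff:
  assumes "x \<in> Field S" "y \<in> Field S"
  shows "ht S x <o ht S y \<longleftrightarrow> lev x < lev y"
  using ord_on_lessThan_ordLess_iff assms ht_ordIso by blast

lemma level_iff:
  "\<alpha> =o ord_on {..<a} \<Longrightarrow> x \<in> level S \<alpha> \<longleftrightarrow> x \<in> Field S \<and> lev x = a"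
  unfolding level_def using ord_on_lessThan_ordIso_iff ht_ordIso by blast

lemma level_ht:
  assumes "x \<in> Field S"
  shows "level S (ht S x) = {y \<in> Field S. lev y = lev x}"
  using ht_ordIso_iff[OF _ assms] by (auto simp: level_def)

lemma limit_ordinal_ht_iff:
  assumes "x \<in> Field S"
  shows "limit_ordinal (ht S x) \<longleftrightarrow> is_limit (lev x)"
proof -
  have wo: "Well_order (ht S x)" using ht_ordIso[OF assms] by (simp add: ordIso_def)
  have field: "Field (ht S x) = underS S x"
    by (auto simp: ht_def underS_def Field_def intro: Field1 refl)
  have aboveS: "aboveS (ht S x) y \<noteq> {} \<longleftrightarrow> (\<exists>c. lev y < c \<and> c < lev x)"
    if "y \<in> underS S x" for y
  proof
    assume "aboveS (ht S x) y \<noteq> {}"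
    then obtain z where "(y, z) \<in> S" "z \<noteq> y" "(z, x) \<in> S" "z \<noteq> x"
      by (auto simp: aboveS_def ht_def underS_def)
    then show "\<exists>c. lev y < c \<and> c < lev x" using lev_less by metis
  next
    assume "\<exists>c. lev y < c \<and> c < lev x"
    then obtain c where c: "lev y < c" "c < lev x" by auto
    then have r: "(restr x c, x) \<in> S" "lev (restr x c) = c"
      using assms restr_below lev_restr by (auto intro: less_imp_le)
    then have "(y, restr x c) \<in> S"
      using below_comparable[of y x "restr x c"] that c by (auto simp: underS_def intro: less_imp_le)
    then have "restr x c \<in> aboveS (ht S x) y"
      using r c that by (auto simp: aboveS_def ht_def underS_def)
    then show "aboveS (ht S x) y \<noteq> {}" by blast
  qed
  have ex: "underS S x \<noteq> {} \<longleftrightarrow> (\<exists>b. b < lev x)"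
    using lev_image_underS[OF assms] by auto
  have all: "(\<forall>b<lev x. Q b) \<longleftrightarrow> (\<forall>y\<in>underS S x. Q (lev y))" for Q
  proof -
    have "(\<forall>b<lev x. Q b) \<longleftrightarrow> (\<forall>b\<in>lev ` underS S x. Q b)"
      by (simp only: lev_image_underS[OF assms]) auto
    then show ?thesis by simp
  qed
  show ?thesis
    unfolding limit_ordinal_def is_limit_def all ex[symmetric] using wo aboveS
    by (simp add: field)
qed

lemma immediate_successors_eq:
  assumes "x \<in> Field S"
  shows "immediate_successors S x = children x"
proof (rule set_eqI)
  fix y
  show "y \<in> immediate_successors S x \<longleftrightarrow> y \<in> children x"
  proof
    assume y: "y \<in> immediate_successors S x"
    then have xy: "(x, y) \<in> S" "x \<noteq> y" by (auto simp: immediate_successors_def aboveS_def)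
    then have less: "lev x < lev y" using lev_less by blast
    then have le: "osuc (lev x) \<le> lev y" by (simp add: osuc_le_iff)
    have yF: "y \<in> Field S" using xy Field2 by blast
    let ?z = "restr y (osuc (lev x))"
    have z: "(?z, y) \<in> S" "lev ?z = osuc (lev x)"
      using restr_below[OF yF le] lev_restr[OF yF le] by auto
    then have xz: "(x, ?z) \<in> S" "?z \<noteq> x"
      using below_comparable[OF xy(1) z(1)] z(2) by (simp_all, metis less_osuc less_irrefl)
    have "?z = y"
    proof (rule ccontr)
      assume "?z \<noteq> y"
      then have "?z \<in> aboveS S x \<inter> underS S y" using xz z by (auto simp: aboveS_def underS_def)
      then show False using y by (auto simp: immediate_successors_def)
    qed
    then show "y \<in> children x" using z xy by (auto simp: children_def)
  next
    assume "y \<in> children x"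
    then have y: "(x, y) \<in> S" "lev y = osuc (lev x)" by (auto simp: children_def)
    then have "x \<noteq> y" by (metis less_osuc less_irrefl)
    moreover have False if "z \<in> aboveS S x \<inter> underS S y" for z
      using that lev_less[of x z] lev_less[of z y] y
      by (auto simp: aboveS_def underS_def less_osuc_iff)
    ultimately show "y \<in> immediate_successors S x"
      using y by (auto simp: immediate_successors_def aboveS_def)
  qed
qed

lemma tree: "tree S"
  unfolding tree_def
proof (intro conjI ballI partial_order)
  fix t assume "t \<in> Field S"
  then show "Well_order (Restr S (underS S t))"
    using ht_ordIso by (simp add: ordIso_def ht_def)
qed

lemma has_height_omega1: "has_height S omega1"
  unfolding has_height_def
proof (intro conjI allI impI Well_order_omega1)
  have "\<not> ht S x =o omega1" if "x \<in> Field S" for x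
    using ht_ordIso[OF that] less_omega1_iff not_ordLess_ordIso by blast
  then show "level S omega1 = {}" by (auto simp: level_def)
  fix \<alpha> :: "nat set rel" assume "\<alpha> <o omega1"
  then obtain a where "\<alpha> =o ord_on {..<a}" using less_omega1_iff by blast
  moreover obtain x where "x \<in> Field S" "lev x = a" using level_nonempty by blast
  ultimately show "level S \<alpha> \<noteq> {}" using level_iff by blast
qed

end

text \<open>
  A node of height at least \<open>\<omega>\<^sub>1\<close> would have a predecessor of height exactly \<open>\<omega>\<^sub>1\<close> or have that height
  itself, but that level is empty. So every height is the order type of a proper initial segment of
  \<open>\<omega>\<^sub>1\<close>.
\<close>

lemma leveled_tree_exists:
  assumes "tree S" "has_height S omega1"
  shows "\<exists>lev. leveled_tree S lev"
proof -
  have po: "Partial_order S" and wo: "\<And>t. t \<in> Field S \<Longrightarrow> Well_order (ht S t)"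
    using assms(1) by (auto simp: tree_def ht_def)
  have trans: "trans S" and refl: "\<And>x. x \<in> Field S \<Longrightarrow> (x, x) \<in> S" and antisym: "antisym S"
    using po by (auto simp: partial_order_on_def preorder_on_def refl_on_def)
  have F: "x \<in> Field S" "y \<in> Field S" if "(x, y) \<in> S" for x y
    using that by (auto simp: Field_def)
  have field_ht: "Field (ht S x) = underS S x" for x
    by (auto simp: ht_def underS_def Field_def intro: refl F)
  have initial: "ht S y = Restr (ht S x) (underS (ht S x) y)" if "y \<in> underS S x" for x y
  proof -
    have "underS (ht S x) y = underS S y"
      using that trans antisym by (auto simp: ht_def underS_def dest: transD antisymD)
    moreover have "underS S y \<subseteq> underS S x"
      using that trans antisym by (auto simp: underS_def dest: transD antisymD)
    ultimately show ?thesis by (auto simp: ht_def)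
  qed
  have seg: "\<alpha> <o ht S x \<longleftrightarrow> (\<exists>y\<in>underS S x. \<alpha> =o ht S y)" if "x \<in> Field S" "Well_order \<alpha>"
    for \<alpha> :: "'c rel" and x
    using ordLess_iff_ordIso_Restr[OF wo[OF that(1)] that(2)] initial
    by (simp add: field_ht)
  have less: "ht S x <o omega1" if x: "x \<in> Field S" for x
  proof (rule ccontr)
    assume "\<not> ht S x <o omega1"
    then have "omega1 =o ht S x \<or> omega1 <o ht S x"
      using Well_order_omega1 wo[OF x] not_ordLess_iff_ordLeq ordLeq_iff_ordLess_or_ordIso
      by blast
    then have "\<exists>y\<in>Field S. ht S y =o omega1"
      using seg[OF x Well_order_omega1] x F ordIso_symmetric
      by (fastforce simp: underS_def)
    then show False using assms(2) by (auto simp: has_height_def level_def)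
  qed
  then have "\<forall>x\<in>Field S. \<exists>a. ht S x =o ord_on {..<a}"
    using less_omega1_iff by blast
  then obtain lev where lev: "\<And>x. x \<in> Field S \<Longrightarrow> ht S x =o ord_on {..<lev x}"
    by metis
  have lev_eqI: "lev x = a" if "x \<in> Field S" "ht S x =o ord_on {..<a}" for x a
    using ord_on_lessThan_ordIso_iff[OF lev[OF that(1)] that(2)]
      ordIso_reflexive[OF wo[OF that(1)]] by simp
  have lev_less: "lev x < lev y" if "x \<in> underS S y" for x y
  proof -
    have xy: "x \<in> Field S" "y \<in> Field S" using that F by (auto simp: underS_def)
    have "ht S x <o ht S y"
      using seg[OF xy(2) wo[OF xy(1)]] that ordIso_reflexive[OF wo[OF xy(1)]] by blast
    then show ?thesis
      using ord_on_lessThan_ordLess_iff[OF lev[OF xy(1)] lev[OF xy(2)]] by simp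
  qed
  have "leveled_tree S lev"
  proof
    show "Partial_order S" by (rule po)
    show "lev x < lev y" if "(x, y) \<in> S" "x \<noteq> y" for x y
      using lev_less that by (simp add: underS_def)
    show "\<exists>x. (x, y) \<in> S \<and> lev x = a" if y: "y \<in> Field S" and a: "a \<le> lev y" for y a
    proof (cases "a = lev y")
      case False
      then have "ord_on {..<a} <o ht S y"
        using a ord_on_lessThan_ordLess_iff[OF ordIso_reflexive[OF Well_order_ord_on] lev[OF y]]
        by simp
      then obtain x where x: "x \<in> underS S y" "ord_on {..<a} =o ht S x"
        using seg[OF y Well_order_ord_on] by blast
      then have "lev x = a" using lev_eqI F ordIso_symmetric by (metis underS_E)
      then show ?thesis using x by (auto simp: underS_def)
    qed (use y refl in auto)
    show "x = y" if "(x, z) \<in> S" "(y, z) \<in> S" "lev x = lev y" for x y z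
    proof (cases "x = z \<or> y = z")
      case True
      then show ?thesis using that lev_less by (metis less_irrefl underS_I)
    next
      case False
      then have "x \<in> Field (ht S z)" "y \<in> Field (ht S z)" "Total (ht S z)"
        using that wo[of z] F field_ht
        by (auto simp: underS_def well_order_on_def linear_order_on_def)
      then have "x = y \<or> (x, y) \<in> ht S z \<or> (y, x) \<in> ht S z"
        by (auto simp: total_on_def)
      then show ?thesis
        using lev_less[of x y] lev_less[of y x] that(3) by (auto simp: ht_def underS_def)
    qed
    show "\<exists>x\<in>Field S. lev x = a" for a
    proof -
      obtain \<alpha> :: "nat set rel" where \<alpha>: "ord_on {..<a} =o \<alpha>" "\<alpha> <o omega1"
        using internalize_ordLess[THEN iffD1, OF ord_on_lessThan_less_omega1] by blast
      then obtain x where "x \<in> level S \<alpha>" using assms(2) unfolding has_height_def by blast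
      then have "x \<in> Field S" "ht S x =o ord_on {..<a}"
        using ordIso_transitive[OF _ ordIso_symmetric[OF \<alpha>(1)]] by (auto simp: level_def)
      then show ?thesis using lev_eqI by blast
    qed
  qed
  then show ?thesis by blast
qed

context leveled_tree
begin

lemma antichain_level: "antichain S {x \<in> Field S. lev x = a}"
  using lev_less by (fastforce simp: antichain_def)

lemma countable_level: "ccc S \<Longrightarrow> countable {x \<in> Field S. lev x = a}"
  using antichain_level by (auto simp: ccc_def)

text \<open>
  An uncountable branch would pass through every level. Choosing on each level a child of the branch
  node that lies off the branch yields an uncountable antichain.
\<close>

lemma countable_branch:
  assumes "ccc S" "branch S B"
    and split: "\<And>x. x \<in> Field S \<Longrightarrow> \<exists>u\<in>children x. \<exists>v\<in>children x. u \<noteq> v"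
  shows "countable B"
proof (rule ccontr)
  assume unc: "uncountable B"
  have BF: "B \<subseteq> Field S" and down: "\<And>x y. x \<in> B \<Longrightarrow> (y, x) \<in> S \<Longrightarrow> y \<in> B"
    and chain: "\<And>x y. x \<in> B \<Longrightarrow> y \<in> B \<Longrightarrow> (x, y) \<in> S \<or> (y, x) \<in> S"
    using assms(2) by (auto simp: branch_def ofilter_def under_def Chains_def)
  have uniq: "x = y" if "x \<in> B" "y \<in> B" "lev x = lev y" for x y
    using chain[OF that(1,2)] that(3) lev_less[of x y] lev_less[of y x] by fastforce
  have "\<exists>x\<in>B. lev x = c" for c
  proof (rule ccontr)
    assume none: "\<not> (\<exists>x\<in>B. lev x = c)"
    have "lev x < c" if "x \<in> B" for x
    proof (rule ccontr)
      assume "\<not> lev x < c"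
      then have "(restr x c, x) \<in> S" "lev (restr x c) = c"
        using restr_below lev_restr BF that by (auto simp: not_less)
      then show False using none down that by blast
    qed
    then have "lev ` B \<subseteq> {..<c}" by auto
    then have "countable (lev ` B)" using countable_lessThan_ord1 countable_subset by blast
    moreover have "inj_on lev B" using uniq by (rule inj_onI)
    ultimately show False using unc countable_image_inj_on by blast
  qed
  then obtain \<beta> where \<beta>: "\<And>c. \<beta> c \<in> B" "\<And>c. lev (\<beta> c) = c" by metis
  have "\<exists>u\<in>children (\<beta> c). u \<noteq> \<beta> (osuc c)" for c
    using split[of "\<beta> c"] \<beta>(1) BF by (metis subsetD)
  then obtain \<sigma> where \<sigma>: "\<And>c. \<sigma> c \<in> children (\<beta> c)" "\<And>c. \<sigma> c \<noteq> \<beta> (osuc c)" by metis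
  have \<sigma>': "(\<beta> c, \<sigma> c) \<in> S" "lev (\<sigma> c) = osuc c" for c
    using \<sigma>(1)[of c] \<beta>(2) by (auto simp: children_def)
  have inc: "(\<sigma> c, \<sigma> d) \<notin> S" if "c \<noteq> d" for c d
  proof
    assume le: "(\<sigma> c, \<sigma> d) \<in> S"
    then have "c < d" using lev_le[OF le] \<sigma>'(2) that osuc_le_iff less_osuc_iff by (metis le_less)
    then have oc: "osuc c \<le> d" by (simp add: osuc_le_iff)
    have "(\<beta> (osuc c), \<beta> d) \<in> S"
      using chain[OF \<beta>(1)[of "osuc c"] \<beta>(1)[of d]] oc lev_less[of "\<beta> d" "\<beta> (osuc c)"] \<beta>(2)
      by (metis not_less)
    then have "(\<beta> (osuc c), \<sigma> d) \<in> S" using \<sigma>'(1) trans by blast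
    then show False using below_unique[OF le] \<sigma>(2) \<sigma>'(2) \<beta>(2) by metis
  qed
  have "antichain S (range \<sigma>)"
    unfolding antichain_def using Field2[OF \<sigma>'(1)] by (auto; metis inc)
  then have "countable (range \<sigma>)" using assms(1) by (simp add: ccc_def)
  moreover have "inj \<sigma>" using \<sigma>'(2) osuc_inject by (metis injI)
  ultimately show False using uncountable_ord1 countable_image_inj_on by blast
qed

text \<open>
  The conditions of a normal \<open>\<aleph>\<^sub>0\<close>-splitting Souslin tree in terms of levels. Countability of branches
  and of the sets of children follows from the countable chain condition.
\<close>

lemma souslin_treeI:
  assumes ccc: "ccc S"
    and root: "\<And>x y. x \<in> Field S \<Longrightarrow> y \<in> Field S \<Longrightarrow> \<forall>a. lev x \<le> a \<Longrightarrow> lev y = lev x \<Longrightarrow> x = y"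
    and extend: "\<And>x a. x \<in> Field S \<Longrightarrow> lev x \<le> a \<Longrightarrow> \<exists>y. (x, y) \<in> S \<and> lev y = a"
    and infinite: "\<And>x. x \<in> Field S \<Longrightarrow> infinite (children x)"
    and limit: "\<And>x y. x \<in> Field S \<Longrightarrow> y \<in> Field S \<Longrightarrow> is_limit (lev x) \<Longrightarrow> lev y = lev x \<Longrightarrow>
      (\<forall>a<lev x. restr x a = restr y a) \<Longrightarrow> x = y"
  shows "souslin_tree S"
proof -
  have split: "\<exists>u\<in>children x. \<exists>v\<in>children x. u \<noteq> v" if x: "x \<in> Field S" for x
  proof (rule ccontr)
    assume none: "\<not> ?thesis"
    obtain u where "u \<in> children x" using infinite[OF x] by (metis all_not_in_conv finite.emptyI)
    then have "children x \<subseteq> {u}" using none by auto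
    then show False using infinite[OF x] finite_subset by blast
  qed
  have "\<exists>!t. t \<in> Field S \<and> underS S t = {}"
  proof -
    obtain z :: ord1 where z: "\<And>a. z \<le> a" using Least_le[of "\<lambda>_. True"] by blast
    obtain r where r: "r \<in> Field S" "lev r = z" using level_nonempty by blast
    have iff: "underS S t = {} \<longleftrightarrow> lev t = z" if "t \<in> Field S" for t
    proof -
      have "underS S t = {} \<longleftrightarrow> {..<lev t} = {}" using lev_image_underS[OF that] by blast
      also have "\<dots> \<longleftrightarrow> lev t = z"
        using z by (metis antisym_conv empty_iff lessThan_iff not_le all_not_in_conv)
      finally show ?thesis .
    qed
    show ?thesis
    proof (rule ex1I[of _ r])
      show "r \<in> Field S \<and> underS S r = {}" using r iff by blast
      fix t assume "t \<in> Field S \<and> underS S t = {}"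
      then show "t = r" using root[OF r(1), of t] r iff z by auto
    qed
  qed
  moreover have "\<exists>u\<in>level S (ht S t). u \<in> aboveS S s"
    if st: "s \<in> Field S" "t \<in> Field S" "ht S s <o ht S t" for s t
  proof -
    have less: "lev s < lev t" using st ht_ordLess_iff by blast
    then obtain u where u: "(s, u) \<in> S" "lev u = lev t"
      using extend[OF st(1) less_imp_le] by blast
    then have "u \<in> aboveS S s" using less by (auto simp: aboveS_def)
    then show ?thesis using u level_ht[OF st(2)] Field2 by blast
  qed
  moreover have "s = t"
    if "s \<in> Field S" "t \<in> Field S" "limit_ordinal (ht S s)" "ht S s =o ht S t"
      "underS S s = underS S t" for s t
  proof (rule limit)
    show eq: "lev t = lev s" using that(4) ht_ordIso_iff[OF that(1,2)] by simp
    show "\<forall>a<lev s. restr s a = restr t a"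
    proof (intro allI impI)
      fix a assume a: "a < lev s"
      then have r: "(restr s a, s) \<in> S" "lev (restr s a) = a"
        using that(1) restr_below lev_restr by (auto intro: less_imp_le)
      then have "restr s a \<in> underS S s" using a by (auto simp: underS_def)
      then have "(restr s a, t) \<in> S" using that(5) by (auto simp: underS_def)
      then show "restr s a = restr t a" using restr_eqI r(2) by metis
    qed
  qed (use that limit_ordinal_ht_iff in auto)
  ultimately have normal: "normal_tree omega1 S"
    unfolding normal_tree_def using split immediate_successors_eq by auto
  have "aleph0_splitting S"
    unfolding aleph0_splitting_def
  proof (intro ballI impI)
    fix t assume t: "t \<in> Field S"
    have "children t \<subseteq> {x \<in> Field S. lev x = osuc (lev t)}"
      using Field2 by (auto simp: children_def)
    then have "countable (children t)" using countable_level[OF ccc] countable_subset by blast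
    then have "|children t| \<le>o natLeq" by (simp add: countable_card_le_natLeq)
    moreover have "natLeq \<le>o |children t|"
      using infinite[OF t] infinite_iff_natLeq_ordLeq by blast
    ultimately show "|immediate_successors S t| =o natLeq"
      using immediate_successors_eq[OF t] ordIso_iff_ordLeq[of "|children t|" natLeq] by simp
  qed
  then show ?thesis
    unfolding souslin_tree_def using tree has_height_omega1 ccc normal countable_branch split by blast
qed

lemma souslin_treeD:
  assumes "souslin_tree S"
  shows "ccc S"
    and "\<lbrakk>x \<in> Field S; y \<in> Field S; \<forall>a. lev x \<le> a; lev y = lev x\<rbrakk> \<Longrightarrow> x = y"
    and "\<lbrakk>x \<in> Field S; lev x \<le> a\<rbrakk> \<Longrightarrow> \<exists>y. (x, y) \<in> S \<and> lev y = a"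
    and "x \<in> Field S \<Longrightarrow> infinite (children x)"
proof -
  show "ccc S" using assms by (simp add: souslin_tree_def)
  have normal: "normal_tree omega1 S" using assms by (simp add: souslin_tree_def)
  show "x = y" if xy: "x \<in> Field S" "y \<in> Field S" "\<forall>a. lev x \<le> a" "lev y = lev x" for x y
  proof -
    have "underS S x = {}" "underS S y = {}"
      using lev_less[of _ x] lev_less[of _ y] xy by (auto simp: underS_def not_le[symmetric])
    moreover have "\<exists>!t. t \<in> Field S \<and> underS S t = {}" using normal by (simp add: normal_tree_def)
    ultimately show ?thesis using xy by blast
  qed
  show extend: "\<exists>y. (x, y) \<in> S \<and> lev y = a" if x: "x \<in> Field S" "lev x \<le> a" for x a
  proof (cases "lev x = a")
    case False
    obtain t where t: "t \<in> Field S" "lev t = a" using level_nonempty by blast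
    then have "ht S x <o ht S t" using False x ht_ordLess_iff by auto
    then obtain u where "u \<in> level S (ht S t)" "u \<in> aboveS S x"
      using normal x t unfolding normal_tree_def by meson
    then show ?thesis using t level_ht by (auto simp: aboveS_def)
  qed (use x in auto)
  show "infinite (children x)" if x: "x \<in> Field S" for x
  proof -
    obtain y where "(x, y) \<in> S" "lev y = osuc (lev x)" using extend[OF x le_osuc] by blast
    moreover then have "y \<noteq> x" by (metis less_osuc less_irrefl)
    ultimately have "y \<in> aboveS S x" by (simp add: aboveS_def)
    then have "|children x| =o natLeq"
      using assms x immediate_successors_eq[OF x]
      by (auto simp: souslin_tree_def aleph0_splitting_def)
    then have "natLeq \<le>o |children x|" by (rule ordIso_imp_ordLeq[OF ordIso_symmetric])
    then show ?thesis using infinite_iff_natLeq_ordLeq by blast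
  qed
qed

text \<open>
  If all nodes of \<open>P\<close> are on one level, then being on the same level of the subtrees amounts to being
  on the same level of the whole tree.
\<close>

lemma tree_product_nodes_iff:
  assumes level: "P \<subseteq> {p \<in> Field S. lev p = a}"
  shows "x \<in> tree_product_nodes omega1 P (subtree S) \<longleftrightarrow>
    x \<in> extensional P \<and> (\<forall>p\<in>P. (p, x p) \<in> S) \<and> (\<exists>b. \<forall>p\<in>P. lev (x p) = b)"
proof -
  have P: "P \<subseteq> Field S" "\<And>p. p \<in> P \<Longrightarrow> lev p = a" using level by auto
  have field: "y \<in> Field (subtree S p) \<longleftrightarrow> (p, y) \<in> S" if "p \<in> P" for p y
  proof
    assume "(p, y) \<in> S"
    then have "(y, y) \<in> subtree S p" using Field2 by (auto simp: subtree_def above_def)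
    then show "y \<in> Field (subtree S p)" by (auto simp: Field_def)
  qed (auto simp: subtree_def above_def Field_def)
  have mem: "y \<in> level (subtree S p) \<alpha> \<longleftrightarrow> (p, y) \<in> S \<and> ord_on {a..<lev y} =o \<alpha>"
    if "p \<in> P" "Well_order \<alpha>" for p y and \<alpha> :: "nat set rel"
    using field[OF that(1)] P(2)[OF that(1)]
      ordIso_cong[OF subtree_below_ordIso[of p y] ordIso_reflexive[OF that(2)]]
    by (auto simp: level_def)
  show ?thesis
  proof
    assume "x \<in> tree_product_nodes omega1 P (subtree S)"
    then obtain \<alpha> :: "nat set rel" where x: "x \<in> (\<Pi>\<^sub>E p\<in>P. level (subtree S p) \<alpha>)"
      and wo: "Well_order \<alpha>"
      by (auto simp: tree_product_nodes_def ordLess_def)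
    then have xp: "(p, x p) \<in> S" "ord_on {a..<lev (x p)} =o \<alpha>" "a \<le> lev (x p)" if "p \<in> P" for p
      using mem[OF that wo] x that lev_le[of p "x p"] P(2)[OF that] by auto
    have "lev (x p) = lev (x q)" if "p \<in> P" "q \<in> P" for p q
      using ord_on_interval_inject[OF
          ordIso_transitive[OF xp(2)[OF that(1)] ordIso_symmetric[OF xp(2)[OF that(2)]]]]
        xp(3)[OF that(1)] xp(3)[OF that(2)] .
    then have "\<exists>b. \<forall>p\<in>P. lev (x p) = b" by metis
    then show "x \<in> extensional P \<and> (\<forall>p\<in>P. (p, x p) \<in> S) \<and> (\<exists>b. \<forall>p\<in>P. lev (x p) = b)"
      using x xp(1) by (auto simp: PiE_def)
  next
    assume x: "x \<in> extensional P \<and> (\<forall>p\<in>P. (p, x p) \<in> S) \<and> (\<exists>b. \<forall>p\<in>P. lev (x p) = b)"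
    then obtain b where b: "\<forall>p\<in>P. lev (x p) = b" by blast
    have "countable {a..<b}"
      by (rule countable_subset[OF _ countable_lessThan_ord1[of b]]) auto
    then have "ord_on {a..<b} <o omega1" using countable_less_omega1[OF Well_order_ord_on] by simp
    then obtain \<alpha> :: "nat set rel" where \<alpha>: "ord_on {a..<b} =o \<alpha>" "\<alpha> <o omega1"
      using internalize_ordLess[THEN iffD1] by blast
    have "x \<in> (\<Pi>\<^sub>E p\<in>P. level (subtree S p) \<alpha>)"
      using x b mem \<alpha> by (auto simp: PiE_def ordLess_def)
    then show "x \<in> tree_product_nodes omega1 P (subtree S)"
      using \<alpha>(2) by (auto simp: tree_product_nodes_def)
  qed
qed

lemma in_tree_product_iff:
  assumes "x \<in> tree_product_nodes omega1 P (subtree S)" "y \<in> tree_product_nodes omega1 P (subtree S)"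
    and P: "P \<subseteq> {p \<in> Field S. lev p = a}"
  shows "(x, y) \<in> tree_product omega1 P (subtree S) \<longleftrightarrow> (\<forall>p\<in>P. (x p, y p) \<in> S)"
  using assms(1,2) tree_product_nodes_iff[OF P]
  by (auto simp: tree_product_def subtree_def above_def)

lemma Field_tree_product:
  assumes P: "P \<subseteq> {p \<in> Field S. lev p = a}"
  shows "Field (tree_product omega1 P (subtree S)) = tree_product_nodes omega1 P (subtree S)"
proof
  show "Field (tree_product omega1 P (subtree S)) \<subseteq> tree_product_nodes omega1 P (subtree S)"
    by (auto simp: tree_product_def Field_def)
  show "tree_product_nodes omega1 P (subtree S) \<subseteq> Field (tree_product omega1 P (subtree S))"
  proof
    fix x assume x: "x \<in> tree_product_nodes omega1 P (subtree S)"
    then have "(x, x) \<in> tree_product omega1 P (subtree S)"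
      using in_tree_product_iff[OF x x P] tree_product_nodes_iff[OF P] Field2 by blast
    then show "x \<in> Field (tree_product omega1 P (subtree S))" by (auto simp: Field_def)
  qed
qed

lemma n_free_iff:
  "n_free n S \<longleftrightarrow>
    (\<forall>a P. P \<subseteq> {x \<in> Field S. lev x = a} \<and> finite P \<and> card P = n \<longrightarrow>
      ccc (tree_product omega1 P (subtree S)))"
proof -
  have level: "level S \<alpha> = {x \<in> Field S. lev x = a}" if "\<alpha> =o ord_on {..<a}"
    for \<alpha> :: "nat set rel" and a
    using level_iff[OF that] by blast
  show ?thesis
  proof (intro iffI allI impI)
    fix a P assume free: "n_free n S"
      and P: "P \<subseteq> {x \<in> Field S. lev x = a} \<and> finite P \<and> card P = n"
    obtain \<alpha> :: "nat set rel" where \<alpha>: "ord_on {..<a} =o \<alpha>" "\<alpha> <o omega1"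
      using internalize_ordLess[THEN iffD1, OF ord_on_lessThan_less_omega1] by blast
    have "P \<subseteq> level S \<alpha>" using P level[OF ordIso_symmetric[OF \<alpha>(1)]] by simp
    then show "ccc (tree_product omega1 P (subtree S))"
      using free P \<alpha>(2) unfolding n_free_def by blast
  next
    assume free: "\<forall>a P. P \<subseteq> {x \<in> Field S. lev x = a} \<and> finite P \<and> card P = n \<longrightarrow>
      ccc (tree_product omega1 P (subtree S))"
    show "n_free n S"
      unfolding n_free_def
    proof (intro allI impI)
      fix \<alpha> :: "nat set rel" and P
      assume P: "\<alpha> <o omega1 \<and> P \<subseteq> level S \<alpha> \<and> finite P \<and> card P = n"
      then obtain a where "\<alpha> =o ord_on {..<a}" using less_omega1_iff by blast
      then have "P \<subseteq> {x \<in> Field S. lev x = a}" using P level by simp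
      then show "ccc (tree_product omega1 P (subtree S))" using P free by blast
    qed
  qed
qed

end

section \<open>Strongly homogeneous trees as coherent trees of labels\<close>

text \<open>
  A label is a finite table, read as a function with default value \<open>0\<close>. Such functions take
  arbitrary values at as many places as the table has entries, but they are nonzero at no more
  places than that.
\<close>

definition look :: "('a \<times> nat) list \<Rightarrow> 'a \<Rightarrow> nat" where
  "look l z = (case map_of l z of None \<Rightarrow> 0 | Some k \<Rightarrow> k)"

lemma card_look_nonzero: "finite {z. look l z \<noteq> 0} \<and> card {z. look l z \<noteq> 0} \<le> length l"
proof -
  have sub: "{z. look l z \<noteq> 0} \<subseteq> fst ` set l"
    by (auto simp: look_def map_of_eq_None_iff split: option.splits)
  moreover have "card (fst ` set l) \<le> length l"
    using card_image_le[of "set l" fst] card_length[of l] by simp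
  ultimately show ?thesis using card_mono[OF _ sub] finite_subset[OF sub] by auto
qed

locale coherent_souslin_tree = leveled_tree S lev for S :: "'a rel" and lev +
  fixes \<psi> :: "'a \<Rightarrow> 'a \<Rightarrow> 'a \<Rightarrow> 'a" and n :: nat
  assumes souslin: "souslin_tree S"
    and coherent: "coherent_family S \<psi>"
    and n_pos: "n > 0"
begin

lemma Field_subtree: "s \<in> Field S \<Longrightarrow> Field (subtree S s) = above S s"
  by (auto simp: subtree_def above_def Field_def intro: Field1 Field2 refl)

lemma psi_iso:
  assumes "s \<in> Field S" "t \<in> Field S" "lev s = lev t"
  shows "bij_betw (\<psi> s t) (above S s) (above S t)"
    and "\<lbrakk>(s, x) \<in> S; (s, y) \<in> S\<rbrakk> \<Longrightarrow> (\<psi> s t x, \<psi> s t y) \<in> S \<longleftrightarrow> (x, y) \<in> S"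
proof -
  have "ht S s =o ht S t" using assms ht_ordIso_iff by simp
  then have "iso (subtree S s) (subtree S t) (\<psi> s t)"
    using coherent assms(1,2) by (simp add: coherent_family_def)
  then have bij: "bij_betw (\<psi> s t) (above S s) (above S t)"
    and emb: "\<forall>a\<in>above S s. \<forall>b\<in>above S s.
      (a, b) \<in> subtree S s \<longleftrightarrow> (\<psi> s t a, \<psi> s t b) \<in> subtree S t"
    by (auto simp: iso_iff2 Field_subtree assms(1,2))
  show "bij_betw (\<psi> s t) (above S s) (above S t)" by (rule bij)
  assume "(s, x) \<in> S" "(s, y) \<in> S"
  then show "(\<psi> s t x, \<psi> s t y) \<in> S \<longleftrightarrow> (x, y) \<in> S"
    using emb bij_betw_apply[OF bij] by (auto simp: subtree_def above_def)
qed

lemma psi_above: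
  "\<lbrakk>(s, x) \<in> S; t \<in> Field S; lev s = lev t\<rbrakk> \<Longrightarrow> (t, \<psi> s t x) \<in> S"
  using bij_betw_apply[OF psi_iso(1), of s t x] Field1 by (auto simp: above_def)

text \<open>
  By induction along the tree: an isomorphism preserves levels since it maps the nodes between \<open>s\<close> and
  \<open>x\<close> onto the nodes between their images.
\<close>

lemma lev_psi:
  assumes "(s, x) \<in> S" "t \<in> Field S" "lev s = lev t"
  shows "lev (\<psi> s t x) = lev x"
  using assms(1)
proof (induction "lev x" arbitrary: x rule: less_induct)
  case less
  have s: "s \<in> Field S" using less.prems Field1 by blast
  have inj: "inj_on (\<psi> s t) (above S s)" and onto: "\<psi> s t ` above S s = above S t"
    using psi_iso(1)[OF s assms(2,3)] by (auto simp: bij_betw_def)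
  have tx: "(t, \<psi> s t x) \<in> S" using psi_above less.prems assms(2,3) by blast
  have xF: "x \<in> Field S" "\<psi> s t x \<in> Field S" using less.prems tx Field2 by blast+
  show ?case
  proof (rule ccontr)
    assume "\<not> ?case"
    then consider "lev (\<psi> s t x) < lev x" | "lev x < lev (\<psi> s t x)" by fastforce
    then show False
    proof cases
      case 1
      let ?z = "restr x (lev (\<psi> s t x))"
      have z: "(?z, x) \<in> S" "lev ?z = lev (\<psi> s t x)"
        using 1 xF by (simp_all add: restr_below less_imp_le)
      have sz: "(s, ?z) \<in> S"
        using below_comparable[OF less.prems z(1)] z(2) lev_le[OF tx] assms(3) by simp
      have "(\<psi> s t ?z, \<psi> s t x) \<in> S" using psi_iso(2)[OF s assms(2,3) sz less.prems] z(1) by simp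
      moreover have "lev (\<psi> s t ?z) = lev (\<psi> s t x)" using less.hyps[of ?z] sz z 1 by simp
      ultimately have "\<psi> s t ?z = \<psi> s t x" using lev_less by fastforce
      then have "?z = x" using inj sz less.prems by (auto simp: inj_on_def above_def)
      then show False using z(2) 1 by simp
    next
      case 2
      let ?w = "restr (\<psi> s t x) (lev x)"
      have w: "(?w, \<psi> s t x) \<in> S" "lev ?w = lev x"
        using 2 xF by (simp_all add: restr_below less_imp_le)
      have "(t, ?w) \<in> S"
        using below_comparable[OF tx w(1)] w(2) lev_le[OF less.prems] assms(3) by simp
      then obtain z where z: "(s, z) \<in> S" "?w = \<psi> s t z" using onto by (auto simp: above_def)
      then have "(z, x) \<in> S" using psi_iso(2)[OF s assms(2,3) z(1) less.prems] w(1) by simp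
      moreover have "z \<noteq> x" using z(2) w(2) 2 by auto
      ultimately have "lev z < lev x" using lev_less by blast
      then show False using less.hyps[OF _ z(1)] z(2) w(2) by simp
    qed
  qed
qed

lemma restr_psi:
  assumes "(s, x) \<in> S" "t \<in> Field S" "lev s = lev t" "lev s \<le> c" "c \<le> lev x"
  shows "restr (\<psi> s t x) c = \<psi> s t (restr x c)"
proof -
  have x: "s \<in> Field S" "x \<in> Field S" using assms(1) Field1 Field2 by blast+
  have r: "(restr x c, x) \<in> S" "lev (restr x c) = c" using x assms by (simp_all add: restr_below)
  have sr: "(s, restr x c) \<in> S" using below_comparable[OF assms(1) r(1)] r(2) assms(4) by simp
  have "(\<psi> s t (restr x c), \<psi> s t x) \<in> S"
    using psi_iso(2)[OF x(1) assms(2,3) sr assms(1)] r(1) by (rule iffD2)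
  then show ?thesis
    by (rule restr_eqI) (simp only: lev_psi[OF sr assms(2,3)] r(2))
qed

lemma restr_psi_base:
  assumes "(s, x) \<in> S" "t \<in> Field S" "lev s = lev t"
  shows "restr (\<psi> s t x) (lev s) = t"
  using restr_eqI[OF psi_above[OF assms]] assms(3) by simp

lemma psi_comp:
  assumes "(r, x) \<in> S" "s \<in> Field S" "t \<in> Field S" "lev r = lev s" "lev s = lev t"
  shows "\<psi> r t x = \<psi> s t (\<psi> r s x)"
proof -
  have r: "r \<in> Field S" using assms(1) Field1 by blast
  have "ht S r =o ht S s \<and> ht S s =o ht S t" using assms r ht_ordIso_iff by simp
  then show ?thesis using coherent r assms(1-3) by (simp add: coherent_family_def above_def)
qed

lemma psi_restrict:
  assumes "(r, t) \<in> S" "(t, x) \<in> S" "s \<in> Field S" "lev r = lev s"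
  shows "\<psi> t (\<psi> r s t) x = \<psi> r s x"
proof -
  have r: "r \<in> Field S" using assms(1) Field1 by blast
  have "ht S r =o ht S s" using assms r ht_ordIso_iff by simp
  then show ?thesis using coherent r assms(1-3) by (simp add: coherent_family_def above_def)
qed

lemma psi_limit:
  assumes "t \<in> Field S" "u \<in> Field S" "lev t = lev u" "is_limit (lev t)"
  shows "\<exists>c<lev t. \<psi> (restr t c) (restr u c) t = u"
proof -
  have "ht S t =o ht S u \<and> limit_ordinal (ht S t)"
    using assms ht_ordIso_iff limit_ordinal_ht_iff by simp
  then have "\<exists>\<gamma> :: 'a rel. \<gamma> <o ht S t \<and>
      (\<forall>r\<in>level S \<gamma> \<inter> underS S t. \<forall>s\<in>level S \<gamma> \<inter> underS S u. \<psi> r s t = u)"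
    using coherent assms(1,2) by (simp add: coherent_family_def)
  then obtain \<gamma> :: "'a rel" where \<gamma>: "\<gamma> <o ht S t"
    "\<And>r s. r \<in> level S \<gamma> \<inter> underS S t \<Longrightarrow> s \<in> level S \<gamma> \<inter> underS S u \<Longrightarrow> \<psi> r s t = u"
    by blast
  have "\<gamma> <o ord_on {..<lev t}" using ordLess_ordIso_trans[OF \<gamma>(1) ht_ordIso[OF assms(1)]] .
  then have "\<exists>c\<in>{..<lev t}. \<gamma> =o ord_on {..<c}"
    by (rule less_ord_on_iff[THEN iffD1, rotated]) (auto intro: le_less_trans)
  then obtain c where c: "c < lev t" "\<gamma> =o ord_on {..<c}" by auto
  have "restr v c \<in> level S \<gamma> \<inter> underS S v" if "v \<in> Field S" "lev v = lev t" for v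
  proof -
    have r: "(restr v c, v) \<in> S" "lev (restr v c) = c"
      using that c by (simp_all add: restr_below less_imp_le)
    moreover have "restr v c \<noteq> v" using r(2) c(1) that(2) by auto
    ultimately show ?thesis using level_iff[OF c(2)] Field1 by (auto simp: underS_def)
  qed
  then have "\<psi> (restr t c) (restr u c) t = u" using \<gamma>(2) assms by simp
  then show ?thesis using c(1) by blast
qed

definition labels :: "ord1 \<Rightarrow> ('a \<times> nat) list set" where
  "labels a = {l. set l \<subseteq> {x \<in> Field S. lev x = a} \<times> UNIV \<and> length l \<le> n}"

text \<open>
  A node on each level, whose children are labelled first; the coherent family then transports
  this labelling to the children of all other nodes of the level.
\<close>

definition ref :: "ord1 \<Rightarrow> 'a" where
  "ref a = (SOME x. x \<in> Field S \<and> lev x = a)"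

definition code :: "ord1 \<Rightarrow> 'a \<Rightarrow> ('a \<times> nat) list" where
  "code a = (SOME f. f ` children (ref a) = labels a)"

text \<open>
  The label that is attached to the predecessor of \<open>x\<close> on level \<open>a + 1\<close>, as a child of the
  predecessor on level \<open>a\<close>.
\<close>

definition lab :: "'a \<Rightarrow> ord1 \<Rightarrow> ('a \<times> nat) list" where
  "lab x a = code a (\<psi> (restr x a) (ref a) (restr x (osuc a)))"

lemma ref: "ref a \<in> Field S" "lev (ref a) = a"
proof -
  have "ref a \<in> Field S \<and> lev (ref a) = a"
    unfolding ref_def by (rule someI_ex) (use level_nonempty[of a] in blast)
  then show "ref a \<in> Field S" "lev (ref a) = a" by auto
qed

lemma countable_labels: "countable (labels a)"
proof -
  have "labels a \<subseteq> lists ({x \<in> Field S. lev x = a} \<times> UNIV)" by (auto simp: labels_def)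
  moreover have "countable (lists ({x \<in> Field S. lev x = a} \<times> (UNIV :: nat set)))"
    using countable_level[OF souslin_treeD(1)[OF souslin]] by (intro countable_lists countable_SIGMA) auto
  ultimately show ?thesis using countable_subset by blast
qed

lemma countable_children: "x \<in> Field S \<Longrightarrow> countable (children x)"
  by (rule countable_subset[OF _ countable_level[OF souslin_treeD(1)[OF souslin], of "osuc (lev x)"]])
    (auto simp: children_def Field2)

text \<open>
  There are only countably many labels on a level, and infinitely many children to carry them.
\<close>

lemma code_image: "code a ` children (ref a) = labels a"
proof -
  let ?C = "children (ref a)"
  have "to_nat_on ?C ` ?C = UNIV"
    using to_nat_on_infinite[OF countable_children souslin_treeD(4)[OF souslin]] ref(1)
    by (auto simp: bij_betw_def)
  moreover have "from_nat_into (labels a) ` UNIV = labels a"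
    using countable_labels by (intro range_from_nat_into) (auto simp: labels_def intro: exI[of _ "[]"])
  ultimately have "(from_nat_into (labels a) \<circ> to_nat_on ?C) ` ?C = labels a"
    by (metis image_comp)
  then show ?thesis unfolding code_def by (rule someI[where P = "\<lambda>f. f ` ?C = labels a"])
qed

lemma lab_restr: "x \<in> Field S \<Longrightarrow> a < c \<Longrightarrow> c \<le> lev x \<Longrightarrow> lab (restr x c) a = lab x a"
  by (simp add: lab_def restr_restr osuc_le_iff less_imp_le)

lemma psi_children:
  assumes "s \<in> Field S" "t \<in> Field S" "lev s = lev t"
  shows "\<psi> s t ` children s = children t"
proof (intro subset_antisym subsetI)
  fix y assume "y \<in> \<psi> s t ` children s"
  then show "y \<in> children t"
    using psi_above lev_psi assms by (auto simp: children_def)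
next
  fix y assume y: "y \<in> children t"
  then obtain x where x: "(s, x) \<in> S" "y = \<psi> s t x"
    using psi_iso(1)[OF assms] by (auto simp: bij_betw_def above_def children_def)
  then have "x \<in> children s" using lev_psi[OF x(1) assms(2,3)] y assms(3) by (simp add: children_def)
  then show "y \<in> \<psi> s t ` children s" using x(2) by blast
qed

lemma lab_in_labels:
  assumes "x \<in> Field S" "a < lev x"
  shows "lab x a \<in> labels a"
proof -
  have "\<psi> (restr x a) (ref a) (restr x (osuc a)) \<in> children (ref a)"
    using psi_children[of "restr x a" "ref a"] restr_osuc_in_children[OF assms] assms ref[of a]
      restr_in_Field[of x a] by (auto simp: less_imp_le)
  then show ?thesis unfolding lab_def using code_image by blast
qed

lemma ex_child_with_label:
  assumes "z \<in> Field S" "l \<in> labels (lev z)"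
  obtains y where "y \<in> children z" "lab y (lev z) = l"
proof -
  have "l \<in> code (lev z) ` children (ref (lev z))"
    using assms(2) by (simp only: code_image)
  then obtain c where c: "c \<in> children (ref (lev z))" "code (lev z) c = l" by blast
  obtain y where y: "y \<in> children z" "\<psi> z (ref (lev z)) y = c"
    using psi_children[of z "ref (lev z)"] assms(1) ref[of "lev z"] c(1) by force
  then have "restr y (lev z) = z" "restr y (osuc (lev z)) = y"
    using restr_eqI[of z y] restr_self[of y] Field2 by (auto simp: children_def)
  then show ?thesis using that[of y] y c by (simp add: lab_def)
qed

text \<open>
  Invariance of the labelling: the restriction of \<open>\<psi> s t\<close> to a predecessor \<open>z\<close> of \<open>x\<close> is again a
  member of the family, and following it by the map to the reference node on that level gives the
  map from \<open>z\<close> to the reference node.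
\<close>

lemma lab_psi:
  assumes "(s, x) \<in> S" "t \<in> Field S" "lev s = lev t" "lev s \<le> a" "a < lev x"
  shows "lab (\<psi> s t x) a = lab x a"
proof -
  have x: "x \<in> Field S" using assms(1) Field2 by blast
  have le: "a \<le> lev x" "osuc a \<le> lev x" "lev s \<le> osuc a"
    using assms(4,5) by (auto simp: osuc_le_iff less_imp_le intro: order_trans[OF _ le_osuc])
  let ?z = "restr x a" and ?y = "restr x (osuc a)"
  have sz: "(s, ?z) \<in> S"
    using below_comparable[OF assms(1) restr_below[OF x le(1)]] assms(4) x le by simp
  have zy: "(?z, ?y) \<in> S" using restr_mono[OF x le_osuc le(2)] .
  have z': "\<psi> s t ?z \<in> Field S" "lev (\<psi> s t ?z) = a"
    using psi_above[OF sz assms(2,3)] Field2 lev_psi[OF sz assms(2,3)] x le by auto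
  have "\<psi> (\<psi> s t ?z) (ref a) (\<psi> s t ?y) = \<psi> (\<psi> s t ?z) (ref a) (\<psi> ?z (\<psi> s t ?z) ?y)"
    using psi_restrict[OF sz zy assms(2,3)] by simp
  also have "\<dots> = \<psi> ?z (ref a) ?y"
    using psi_comp[OF zy z'(1) ref(1)] z'(2) ref(2) x le by simp
  finally show ?thesis
    unfolding lab_def using restr_psi[OF assms(1-3)] assms(4) le by simp
qed

text \<open>
  A chosen node that makes the same moves as \<open>x\<close> on all earlier levels. The moves depend on the
  representatives on these levels, hence the recursion over \<open>lev\<close>.
\<close>

definition rep_step :: "('a \<Rightarrow> 'a) \<Rightarrow> 'a \<Rightarrow> 'a" where
  "rep_step f x = (SOME y. y \<in> Field S \<and> lev y = lev x \<and>
     (\<forall>a<lev x. look (lab y a) (f (restr y a)) = look (lab x a) (f (restr x a))))"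

definition rep :: "'a \<Rightarrow> 'a" where
  "rep = wfrec (inv_image {(a, b). a < b} lev) rep_step"

text \<open>
  The number of the step that the walk from the root guided by \<open>x\<close> takes on level \<open>a\<close>. When it
  gets there, this walk stands at the class of the predecessor of \<open>x\<close>.
\<close>

definition move :: "'a \<Rightarrow> ord1 \<Rightarrow> nat" where
  "move x a = look (lab x a) (rep (restr x a))"

text \<open>
  Well-founded recursion, with \<open>move\<close> in place of the recursive calls.
\<close>

lemma rep_unfold:
  assumes "x \<in> Field S"
  shows "rep x = (SOME y. y \<in> Field S \<and> lev y = lev x \<and> (\<forall>a<lev x. move y a = move x a))"
proof -
  let ?R = "inv_image {(a, b :: ord1). a < b} lev"
  have wf: "wf ?R" by (intro wf_inv_image wf)
  have cut: "cut rep ?R x (restr y a) = rep (restr y a)"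
    if "y \<in> Field S" "lev y = lev x" "a < lev x" for y a
    using that by (simp add: cut_def less_imp_le)
  have "rep x = rep_step (cut rep ?R x) x"
    unfolding rep_def using wfrec[OF wf] .
  also have "\<dots> = (SOME y. y \<in> Field S \<and> lev y = lev x \<and> (\<forall>a<lev x. move y a = move x a))"
    unfolding rep_step_def move_def using cut assms by (intro arg_cong[where f = Eps] ext) auto
  finally show ?thesis .
qed

lemma
  assumes "x \<in> Field S"
  shows rep_in_Field [simp]: "rep x \<in> Field S" and lev_rep [simp]: "lev (rep x) = lev x"
    and move_rep: "a < lev x \<Longrightarrow> move (rep x) a = move x a"
proof -
  have "rep x \<in> Field S \<and> lev (rep x) = lev x \<and> (\<forall>a<lev x. move (rep x) a = move x a)"
    unfolding rep_unfold[OF assms] by (rule someI[of _ x]) (use assms in auto)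
  then show "rep x \<in> Field S" "lev (rep x) = lev x"
    "a < lev x \<Longrightarrow> move (rep x) a = move x a" by auto
qed

text \<open>
  Nodes with the same moves have the same set of candidates for the representative.
\<close>

lemma rep_eq_iff:
  assumes "x \<in> Field S" "y \<in> Field S"
  shows "rep x = rep y \<longleftrightarrow> lev x = lev y \<and> (\<forall>a<lev x. move x a = move y a)"
proof
  assume "rep x = rep y"
  then show "lev x = lev y \<and> (\<forall>a<lev x. move x a = move y a)"
    using lev_rep move_rep assms by metis
next
  assume "lev x = lev y \<and> (\<forall>a<lev x. move x a = move y a)"
  then show "rep x = rep y"
    unfolding rep_unfold[OF assms(1)] rep_unfold[OF assms(2)]
    by (intro arg_cong[where f = Eps] ext) auto
qed

lemma rep_rep [simp]: "x \<in> Field S \<Longrightarrow> rep (rep x) = rep x"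
  by (simp add: rep_eq_iff move_rep)

lemma move_restr: "x \<in> Field S \<Longrightarrow> a < c \<Longrightarrow> c \<le> lev x \<Longrightarrow> move (restr x c) a = move x a"
  by (simp add: move_def lab_restr restr_restr less_imp_le)

lemma rep_restr_cong:
  assumes "x \<in> Field S" "y \<in> Field S" "rep x = rep y" "a \<le> lev x"
  shows "rep (restr x a) = rep (restr y a)"
  using assms by (simp add: rep_eq_iff restr_in_Field move_restr)

lemma rep_restr_rep: "x \<in> Field S \<Longrightarrow> a \<le> lev x \<Longrightarrow> rep (restr (rep x) a) = rep (restr x a)"
  using rep_restr_cong[of "rep x" x a] by simp

end

section \<open>The quotient tree\<close>

context coherent_souslin_tree
begin

text \<open>
  The order on classes induced by \<open>S\<close>: \<open>s\<close> lies below \<open>t\<close> if it represents the predecessor of \<open>t\<close> on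
  the level of \<open>s\<close>.
\<close>

definition T :: "'a rel" where
  "T = {(s, t). s \<in> rep ` Field S \<and> t \<in> rep ` Field S \<and> lev s \<le> lev t \<and>
    rep (restr t (lev s)) = s}"

lemma in_rep_image_iff: "x \<in> rep ` Field S \<longleftrightarrow> x \<in> Field S \<and> rep x = x"
  by (force intro: rev_image_eqI)

lemma T_iff:
  "(s, t) \<in> T \<longleftrightarrow> s \<in> Field S \<and> rep s = s \<and> t \<in> Field S \<and> rep t = t \<and>
    lev s \<le> lev t \<and> rep (restr t (lev s)) = s"
  by (auto simp: T_def in_rep_image_iff)

lemma T_mono: "(x, y) \<in> S \<Longrightarrow> (rep x, rep y) \<in> T"
  using lev_le restr_eq by (auto simp: T_iff Field1 Field2 rep_restr_rep)

lemma Field_T_iff: "x \<in> Field T \<longleftrightarrow> x \<in> Field S \<and> rep x = x"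
proof
  assume "x \<in> Field S \<and> rep x = x"
  then have "(x, x) \<in> T" by (simp add: T_iff)
  then show "x \<in> Field T" by (auto simp: Field_def)
qed (auto simp: Field_def T_iff)

lemma T_restr: "t \<in> Field T \<Longrightarrow> a \<le> lev t \<Longrightarrow> (rep (restr t a), t) \<in> T"
  by (simp add: T_iff Field_T_iff restr_in_Field)

text \<open>
  Equivalent nodes have equivalent predecessors, so the tree structure of \<open>S\<close> passes to the classes.
\<close>

lemma leveled_T: "leveled_tree T lev"
proof
  have trans: "(s, u) \<in> T" if "(s, t) \<in> T" "(t, u) \<in> T" for s t u
  proof -
    have st: "s \<in> Field S" "t \<in> Field S" "u \<in> Field S" "lev s \<le> lev t" "lev t \<le> lev u"
      "rep (restr u (lev t)) = rep t" "rep (restr t (lev s)) = s" "rep s = s" "rep u = u"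
      using that by (auto simp: T_iff)
    have "rep (restr (restr u (lev t)) (lev s)) = rep (restr t (lev s))"
      using rep_restr_cong[OF restr_in_Field[OF st(3,5)] st(2,6)] st by simp
    then have "rep (restr u (lev s)) = s" using st by (simp add: restr_restr)
    then show ?thesis using st by (simp add: T_iff)
  qed
  have antisym: "s = t" if "(s, t) \<in> T" "lev t \<le> lev s" for s t
  proof -
    have "lev s = lev t" "rep (restr t (lev s)) = s" "rep t = t" "t \<in> Field S"
      using that unfolding T_iff by auto
    then show ?thesis by (metis restr_self)
  qed
  show "Partial_order T"
    unfolding partial_order_on_def preorder_on_def refl_on_def trans_def antisym_def
  proof (intro conjI allI impI ballI subsetI)
    show "(x, x) \<in> T" if "x \<in> Field T" for x using that by (simp add: T_iff Field_T_iff)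
    show "x = y" if "(x, y) \<in> T" "(y, x) \<in> T" for x y
      using antisym[OF that(1)] that(2) by (simp add: T_iff)
  qed (use trans in \<open>auto simp: Field_def\<close>)
  show "lev x < lev y" if "(x, y) \<in> T" "x \<noteq> y" for x y
    using antisym that by (meson not_le)
  show "\<exists>x. (x, y) \<in> T \<and> lev x = a" if "y \<in> Field T" "a \<le> lev y" for y a
    using T_restr[OF that] that by (intro exI[of _ "rep (restr y a)"])
      (simp add: Field_T_iff restr_in_Field)
  show "x = y" if "(x, z) \<in> T" "(y, z) \<in> T" "lev x = lev y" for x y z
    using that by (auto simp: T_iff)
  show "\<exists>x\<in>Field T. lev x = a" for a
  proof -
    obtain x where "x \<in> Field S" "lev x = a" using level_nonempty by blast
    then show ?thesis by (intro bexI[of _ "rep x"]) (auto simp: Field_T_iff)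
  qed
qed

interpretation T: leveled_tree T lev
  by (rule leveled_T)

lemma T_restr_eq: "t \<in> Field T \<Longrightarrow> a \<le> lev t \<Longrightarrow> T.restr t a = rep (restr t a)"
  by (rule T.restr_eqI[OF T_restr]) (auto simp: Field_T_iff restr_in_Field)

section \<open>The quotient is a Souslin tree\<close>

lemma ex_child_with_move:
  assumes "x \<in> Field S"
  obtains y where "y \<in> children x" "move y (lev x) = k"
proof -
  have "[(rep x, k)] \<in> labels (lev x)" using assms n_pos by (auto simp: labels_def)
  then obtain y where y: "y \<in> children x" "lab y (lev x) = [(rep x, k)]"
    using ex_child_with_label[OF assms] by blast
  moreover have "restr y (lev x) = x" using y(1) restr_eq by (auto simp: children_def)
  ultimately show ?thesis using that[of y] by (simp add: move_def look_def)
qed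

text \<open>
  Nodes of \<open>T\<close> are their own representatives, so if they are comparable in \<open>S\<close> they are comparable
  in \<open>T\<close>.
\<close>

lemma ccc_T: "ccc T"
  unfolding ccc_def
proof (intro allI impI)
  fix A assume A: "antichain T A"
  have "(x, y) \<notin> S" if "x \<in> A" "y \<in> A" "x \<noteq> y" for x y
    using T_mono[of x y] that A by (auto simp: antichain_def Field_T_iff subset_iff)
  then have "antichain S A" using A by (auto simp: antichain_def Field_T_iff subset_iff)
  then show "countable A" using souslin_treeD(1)[OF souslin] by (simp add: ccc_def)
qed

text \<open>
  Limit nodes of \<open>T\<close> are determined by their predecessors because a class is determined by its moves
  on earlier levels, and these can be read off from the predecessors. The children of a node are
  told apart by the last move, which can be any number.
\<close>

lemma souslin_T: "souslin_tree T"
proof (rule T.souslin_treeI)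
  show "ccc T" by (rule ccc_T)
  show "x = y" if "x \<in> Field T" "y \<in> Field T" "\<forall>a. lev x \<le> a" "lev y = lev x" for x y
    using souslin_treeD(2)[OF souslin] that by (simp add: Field_T_iff)
  show "\<exists>y. (x, y) \<in> T \<and> lev y = a" if x: "x \<in> Field T" "lev x \<le> a" for x a
  proof -
    obtain y where "(x, y) \<in> S" "lev y = a"
      using souslin_treeD(3)[OF souslin] x by (auto simp: Field_T_iff)
    then show ?thesis
      using T_mono[of x y] x by (intro exI[of _ "rep y"]) (simp add: Field_T_iff Field2)
  qed
  show "infinite (T.children x)" if x: "x \<in> Field T" for x
  proof -
    have xS: "x \<in> Field S" "rep x = x" using x by (simp_all add: Field_T_iff)
    have "\<exists>y\<in>children x. move y (lev x) = k" for k
      using ex_child_with_move[OF xS(1)] by blast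
    then obtain y where y: "\<And>k. y k \<in> children x" "\<And>k. move (y k) (lev x) = k" by metis
    have child: "(x, y k) \<in> S" "lev (y k) = osuc (lev x)" for k
      using y(1)[of k] by (auto simp: children_def)
    have "rep (y k) \<in> T.children x" for k
      using T_mono[OF child(1)[of k]] xS child(2)[of k] Field2[OF child(1)[of k]]
      by (simp add: T.children_def)
    moreover have "inj (\<lambda>k. rep (y k))"
    proof (rule injI)
      fix j k assume "rep (y j) = rep (y k)"
      then have "move (y j) (lev x) = move (y k) (lev x)"
        using rep_eq_iff[of "y j" "y k"] Field2[OF child(1)] child(2) by simp
      then show "j = k" using y(2) by simp
    qed
    ultimately show ?thesis
      using infinite_iff_countable_subset[of "T.children x"] by blast
  qed
  show "x = y"
    if xy: "x \<in> Field T" "y \<in> Field T" "is_limit (lev x)" "lev y = lev x"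
      "\<forall>a<lev x. T.restr x a = T.restr y a" for x y
  proof -
    have F: "x \<in> Field S" "y \<in> Field S" "rep x = x" "rep y = y"
      using xy(1,2) by (simp_all add: Field_T_iff)
    have "move x a = move y a" if a: "a < lev x" for a
    proof -
      obtain c where "a < c" "c < lev x" using xy(3) a by (auto simp: is_limit_def)
      then have c: "a < c" "c \<le> lev x" "c \<le> lev y" "c < lev x"
        using xy(4) by auto
      have "rep (restr x c) = rep (restr y c)"
        using xy(5) T_restr_eq xy(1,2) c by metis
      then have "move (restr x c) a = move (restr y c) a"
        using rep_eq_iff[OF restr_in_Field[OF F(1) c(2)] restr_in_Field[OF F(2) c(3)]] F c by simp
      then show ?thesis using F c move_restr by simp
    qed
    then have "rep x = rep y" using F(1,2) xy(4) by (simp add: rep_eq_iff)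
    then show ?thesis using F by simp
  qed
qed

section \<open>Common guides and freeness\<close>

text \<open>
  From level \<open>a\<close> on, the class of \<open>u\<close> moves as the labels of \<open>s\<close> prescribe for a walker that stands at
  the classes below \<open>u\<close>. The walk may have been guided differently below \<open>a\<close>.
\<close>

definition follows :: "'a \<Rightarrow> 'a \<Rightarrow> ord1 \<Rightarrow> bool" where
  "follows s u a \<longleftrightarrow> lev u = lev s \<and>
    (\<forall>c. a \<le> c \<and> c < lev s \<longrightarrow> move u c = look (lab s c) (rep (restr u c)))"

lemma follows_same_labels:
  assumes "lev u = lev s" "\<And>c. a \<le> c \<Longrightarrow> c < lev s \<Longrightarrow> lab u c = lab s c"
  shows "follows s u a"
  using assms by (simp add: follows_def move_def)

lemma follows_restr:
  assumes "follows s u a" "s \<in> Field S" "u \<in> Field S" "b \<le> lev s"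
  shows "follows (restr s b) (restr u b) a"
  using assms less_le_trans[of _ b "lev s"]
  by (simp add: follows_def move_restr lab_restr restr_restr less_imp_le)

text \<open>
  A walk is determined by its guide and its starting point: by induction on the level, equal classes
  so far make equal next moves, and a class is determined by its earlier moves.
\<close>

lemma follows_unique:
  assumes "follows s u a" "follows s v a" "u \<in> Field S" "v \<in> Field S"
    and "a \<le> lev s" "rep (restr u a) = rep (restr v a)"
  shows "rep u = rep v"
proof -
  have lev: "lev u = lev s" "lev v = lev s" using assms(1,2) by (auto simp: follows_def)
  have move_eq: "move u c = move v c" if "c < lev s" for c
    using that
  proof (induction c rule: less_induct)
    case (less c)
    show ?case
    proof (cases "c < a")
      case True
      then have "move (restr u a) c = move (restr v a) c"
        using assms(3-6) lev rep_eq_iff[of "restr u a" "restr v a"] by (simp add: restr_in_Field)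
      then show ?thesis using True assms(3-5) lev by (simp add: move_restr)
    next
      case False
      have "rep (restr u c) = rep (restr v c)"
        using less assms(3,4) lev by (simp add: rep_eq_iff restr_in_Field less_imp_le move_restr)
      then show ?thesis using assms(1,2) less.prems False by (simp add: follows_def)
    qed
  qed
  then show ?thesis using assms(3,4) lev by (simp add: rep_eq_iff)
qed

text \<open>
  Interpolation by a table: as \<open>f\<close> is injective, no entry hides another one.
\<close>

lemma look_map_of_inj:
  assumes "finite I" "inj_on f I"
  obtains l where "\<And>i. i \<in> I \<Longrightarrow> look l (f i) = g i" "set l \<subseteq> f ` I \<times> UNIV" "length l = card I"
proof -
  obtain xs where xs: "set xs = I" "distinct xs" using finite_distinct_list[OF assms(1)] by blast
  let ?l = "map (\<lambda>i. (f i, g i)) xs"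
  have "distinct (map fst ?l)" using xs assms(2) by (simp add: distinct_map o_def)
  then have "map_of ?l (f i) = Some (g i)" if "i \<in> I" for i
    by (rule map_of_is_SomeI) (use that xs(1) in auto)
  then have "look ?l (f i) = g i" if "i \<in> I" for i
    using that by (simp add: look_def)
  moreover have "set ?l \<subseteq> f ` I \<times> UNIV" using xs by auto
  moreover have "length ?l = card I" using xs by (auto simp: distinct_card)
  ultimately show ?thesis by (rule that)
qed

text \<open>
  Induction on \<open>b\<close>. If \<open>b\<close> is the successor of \<open>d\<close>, a guide up to \<open>d\<close> is extended by a child whose label
  interpolates the last moves; the nodes \<open>u i\<close> are in distinct classes on level \<open>d\<close> since they are so
  already on the level of \<open>s0\<close>. If \<open>b\<close> is a limit, any node \<open>w\<close> of level \<open>b\<close> has the same labels as each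
  of the finitely many \<open>u i\<close> from some level \<open>d < b\<close> on; a guide \<open>s'\<close> up to \<open>d\<close> is then continued
  above \<open>d\<close> by the image of \<open>w\<close> under the isomorphism of the subtree of \<open>restr w d\<close> with that of \<open>s'\<close>.
\<close>

lemma ex_common_guide:
  fixes u :: "'i \<Rightarrow> 'a"
  assumes "finite I" "card I \<le> n" "s0 \<in> Field S" "lev s0 \<le> b"
    and "\<And>i. i \<in> I \<Longrightarrow> u i \<in> Field S" "\<And>i. i \<in> I \<Longrightarrow> lev (u i) = b"
    and "inj_on (\<lambda>i. rep (restr (u i) (lev s0))) I"
  shows "\<exists>s. (s0, s) \<in> S \<and> lev s = b \<and> (\<forall>i\<in>I. follows s (u i) (lev s0))"
  using assms(4-)
proof (induction b arbitrary: u rule: less_induct)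
  case (less b)
  note u = less.prems(2,3)
  let ?a = "lev s0"
  have step: "\<exists>s. (s0, s) \<in> S \<and> lev s = c \<and> (\<forall>i\<in>I. follows s (restr (u i) c) ?a)"
    if c: "?a \<le> c" "c < b" for c
  proof (rule less.IH[OF c(2,1)])
    show "inj_on (\<lambda>i. rep (restr (restr (u i) c) ?a)) I"
      using less.prems(4) c u by (simp add: restr_restr inj_on_def less_imp_le)
  qed (use u c in \<open>auto simp: restr_in_Field less_imp_le\<close>)
  show ?case
  proof (cases "?a = b")
    case True
    then show ?thesis using assms(3) u by (intro exI[of _ s0]) (auto simp: follows_def)
  next
    case False
    then have "?a < b" using less.prems(1) by simp
    then show ?thesis
    proof (cases rule: less_or_limit_cases)
      case (1 d)
      then have db: "d < b" by simp
      then obtain s' where s': "(s0, s') \<in> S" "lev s' = d" "\<forall>i\<in>I. follows s' (restr (u i) d) ?a"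
        using step 1(2) by blast
      have s'F: "s' \<in> Field S" using s'(1) Field2 by blast
      have inj: "inj_on (\<lambda>i. rep (restr (u i) d)) I"
      proof (rule inj_onI)
        fix i j assume ij: "i \<in> I" "j \<in> I" "rep (restr (u i) d) = rep (restr (u j) d)"
        have "rep (restr (restr (u i) d) ?a) = rep (restr (restr (u j) d) ?a)"
          using rep_restr_cong[OF _ _ ij(3)] u ij(1,2) 1(2) db by (simp add: restr_in_Field less_imp_le)
        then have "rep (restr (u i) ?a) = rep (restr (u j) ?a)"
          using u ij 1(2) db by (simp add: restr_restr less_imp_le)
        then show "i = j" using less.prems(4) ij by (simp add: inj_on_def)
      qed
      obtain l where l: "\<And>i. i \<in> I \<Longrightarrow> look l (rep (restr (u i) d)) = move (u i) d"
        "set l \<subseteq> (\<lambda>i. rep (restr (u i) d)) ` I \<times> UNIV" "length l = card I"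
        by (rule look_map_of_inj[OF assms(1) inj, of "\<lambda>i. move (u i) d"]) blast
      have "(\<lambda>i. rep (restr (u i) d)) ` I \<subseteq> {x \<in> Field S. lev x = d}"
        using u db by (auto simp: restr_in_Field less_imp_le)
      then have "l \<in> labels (lev s')" using l(2,3) assms(2) s'(2) by (fastforce simp: labels_def)
      then obtain s where s: "s \<in> children s'" "lab s (lev s') = l"
        using ex_child_with_label[OF s'F] by blast
      then have s_above: "(s', s) \<in> S" "lev s = b" using s'(2) 1(1) by (auto simp: children_def)
      then have sF: "s \<in> Field S" "restr s d = s'" using Field2 restr_eqI s'(2) by blast+
      have "follows s (u i) ?a" if i: "i \<in> I" for i
        unfolding follows_def
      proof (intro conjI allI impI)
        show "lev (u i) = lev s" using u i s_above by simp
        fix c assume c: "?a \<le> c \<and> c < lev s"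
        then consider "c < d" | "c = d" using 1(1) s_above(2) by (fastforce simp: less_osuc_iff)
        then show "move (u i) c = look (lab s c) (rep (restr (u i) c))"
        proof cases
          case 1
          then have "move (restr (u i) d) c = look (lab s' c) (rep (restr (restr (u i) d) c))"
            using s'(3) i c s'(2) by (auto simp: follows_def)
          moreover have "lab s' c = lab s c"
            using lab_restr[of s c d] sF 1 db s_above(2) by (simp add: less_imp_le)
          ultimately show ?thesis
            using 1 u i db by (simp add: move_restr restr_restr less_imp_le)
        next
          case 2
          then show ?thesis using l(1)[OF i] s(2) s'(2) by simp
        qed
      qed
      then show ?thesis using trans[OF s'(1) s_above(1)] s_above(2) by blast
    next
      case 2
      obtain w where w: "w \<in> Field S" "lev w = b" using level_nonempty by blast
      have "\<exists>c<b. \<psi> (restr w c) (restr (u i) c) w = u i" if "i \<in> I" for i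
        using psi_limit[OF w(1) u(1)[OF that]] u(2)[OF that] w(2) 2 by simp
      then obtain c where c: "\<And>i. i \<in> I \<Longrightarrow> c i < b"
        "\<And>i. i \<in> I \<Longrightarrow> \<psi> (restr w (c i)) (restr (u i) (c i)) w = u i" by metis
      define d where "d = Max (insert ?a (c ` I))"
      have fin: "finite (insert ?a (c ` I))" using assms(1) by simp
      have d: "?a \<le> d" "d < b" "\<And>i. i \<in> I \<Longrightarrow> c i \<le> d"
        using fin Max_in[OF fin] c(1) \<open>?a < b\<close> by (auto simp: d_def)
      obtain s' where s': "(s0, s') \<in> S" "lev s' = d" "\<forall>i\<in>I. follows s' (restr (u i) d) ?a"
        using step d by blast
      have s'F: "s' \<in> Field S" using s'(1) Field2 by blast
      define s where "s = \<psi> (restr w d) s' w"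
      have wd: "(restr w d, w) \<in> S" "lev (restr w d) = lev s'"
        using w d s'(2) by (simp_all add: restr_below less_imp_le)
      have s: "(s', s) \<in> S" "lev s = b" "restr s d = s'"
        using psi_above[OF wd(1) s'F wd(2)] lev_psi[OF wd(1) s'F wd(2)]
          restr_psi_base[OF wd(1) s'F wd(2)] w(2) wd(2) s'(2) by (auto simp: s_def)
      have sF: "s \<in> Field S" using s(1) Field2 by blast
      have lab_s: "lab s e = lab w e" if "d \<le> e" "e < b" for e
        using lab_psi[OF wd(1) s'F wd(2)] that w(2) wd(2) s'(2) by (simp add: s_def)
      \<comment> \<open>\<open>u i\<close> is the image of \<open>w\<close> under an isomorphism that starts on level \<open>c i\<close>, at or below \<open>d\<close>.\<close>
      have lab_u: "lab (u i) e = lab w e" if "i \<in> I" "d \<le> e" "e < b" for i e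
      proof -
        have ci: "c i < b" "c i \<le> e" using c(1) d(3)[OF that(1)] that by auto
        have "(restr w (c i), w) \<in> S" "restr (u i) (c i) \<in> Field S"
          "lev (restr w (c i)) = lev (restr (u i) (c i))" "lev (restr w (c i)) = c i"
          using w u that(1) ci by (simp_all add: restr_below restr_in_Field less_imp_le)
        from lab_psi[OF this(1-3)] this(4) show ?thesis
          using c(2)[OF that(1)] ci that w(2) by simp
      qed
      have "follows s (u i) ?a" if i: "i \<in> I" for i
        unfolding follows_def
      proof (intro conjI allI impI)
        show "lev (u i) = lev s" using u i s by simp
        fix e assume e: "?a \<le> e \<and> e < lev s"
        show "move (u i) e = look (lab s e) (rep (restr (u i) e))"
        proof (cases "e < d")
          case True
          then have "move (restr (u i) d) e = look (lab s' e) (rep (restr (restr (u i) d) e))"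
            using s'(3) i e s'(2) by (auto simp: follows_def)
          moreover have "lab s' e = lab s e"
            using lab_restr[OF sF True] s d by (simp add: less_imp_le)
          ultimately show ?thesis
            using True u i d by (simp add: move_restr restr_restr less_imp_le)
        next
          case False
          then show ?thesis using lab_s[of e] lab_u[OF i, of e] e s(2) by (simp add: move_def)
        qed
      qed
      then show ?thesis using trans[OF s'(1) s(1)] s(2) by blast
    qed
  qed
qed

text \<open>
  Fix a node \<open>s0\<close> of \<open>S\<close> on the level of \<open>P\<close>, and let \<open>g x\<close> be a common guide above \<open>s0\<close> for the
  components of \<open>x\<close>. If \<open>g x\<close> lies below \<open>g y\<close>, then the components of \<open>x\<close> and the restrictions of those
  of \<open>y\<close> are walks with the same guide and the same starting points, so \<open>x\<close> lies below \<open>y\<close>.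
\<close>

lemma n_free_T: "n_free n T"
  unfolding T.n_free_iff
proof (intro allI impI)
  fix a P assume "P \<subseteq> {x \<in> Field T. lev x = a} \<and> finite P \<and> card P = n"
  then have level: "P \<subseteq> {x \<in> Field T. lev x = a}" and fin: "finite P" "card P = n" by auto
  then have P: "P \<subseteq> Field T" "\<And>p. p \<in> P \<Longrightarrow> lev p = a" by auto
  have PS: "p \<in> Field S" "rep p = p" if "p \<in> P" for p using P(1) that by (auto simp: Field_T_iff)
  obtain p0 where p0: "p0 \<in> P" using fin n_pos by fastforce
  obtain s0 where s0: "s0 \<in> Field S" "lev s0 = a" using level_nonempty by blast
  let ?N = "tree_product_nodes omega1 P (subtree T)"
  show "ccc (tree_product omega1 P (subtree T))"
    unfolding ccc_def
  proof (intro allI impI)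
    fix A assume A: "antichain (tree_product omega1 P (subtree T)) A"
    have AN: "x \<in> ?N" if "x \<in> A" for x
      using A that T.Field_tree_product[OF level] by (auto simp: antichain_def)
    have node: "x \<in> extensional P \<and> (\<forall>p\<in>P. (p, x p) \<in> T) \<and> (\<exists>b. \<forall>p\<in>P. lev (x p) = b)"
      if "x \<in> A" for x
      using AN[OF that] unfolding T.tree_product_nodes_iff[OF level] .
    have nodes: "p \<in> P \<Longrightarrow> x p \<in> Field S \<and> rep (x p) = x p"
      "p \<in> P \<Longrightarrow> lev (x p) = lev (x p0)"
      "p \<in> P \<Longrightarrow> rep (restr (x p) a) = p" if "x \<in> A" for x p
      using node[OF that] p0 P(2) by (auto simp: T_iff)
    have above: "a \<le> lev (x p0)" if "x \<in> A" for x
      using node[OF that] p0 P(2)[OF p0] by (auto simp: T_iff)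
    have "\<exists>s. (s0, s) \<in> S \<and> lev s = lev (x p0) \<and> (\<forall>p\<in>P. follows s (x p) a)" if "x \<in> A" for x
      using ex_common_guide[of P s0 "lev (x p0)" x] nodes[OF that] above[OF that] fin s0
      by (simp add: inj_on_def)
    then obtain g where g: "\<And>x. x \<in> A \<Longrightarrow> (s0, g x) \<in> S" "\<And>x. x \<in> A \<Longrightarrow> lev (g x) = lev (x p0)"
      "\<And>x p. x \<in> A \<Longrightarrow> p \<in> P \<Longrightarrow> follows (g x) (x p) a" by metis
    have eq: "x = y" if "x \<in> A" "y \<in> A" "(g x, g y) \<in> S" for x y
    proof -
      have le: "lev (x p0) \<le> lev (y p0)" using lev_le[OF that(3)] g(2) that by simp
      have gF: "g y \<in> Field S" using that(3) Field2 by blast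
      have "(x p, y p) \<in> T" if p: "p \<in> P" for p
      proof -
        let ?v = "restr (y p) (lev (g x))"
        have lev: "lev (g x) = lev (x p)" "lev (g x) \<le> lev (y p)" "lev (g x) \<le> lev (g y)" "a \<le> lev (g x)"
          using nodes[OF \<open>x \<in> A\<close>] nodes[OF \<open>y \<in> A\<close>] above g(2) \<open>x \<in> A\<close> \<open>y \<in> A\<close> p le by auto
        have F: "x p \<in> Field S" "y p \<in> Field S" "rep (x p) = x p" "rep (y p) = y p"
          using nodes(1) \<open>x \<in> A\<close> \<open>y \<in> A\<close> p by auto
        have "follows (restr (g y) (lev (g x))) ?v a"
          using follows_restr[OF g(3)[OF \<open>y \<in> A\<close> p] gF F(2) lev(3)] .
        then have "follows (g x) ?v a" using restr_eq[OF \<open>(g x, g y) \<in> S\<close>] by simp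
        moreover have "rep (restr (x p) a) = rep (restr ?v a)"
          using nodes(3) \<open>x \<in> A\<close> \<open>y \<in> A\<close> p F lev by (simp add: restr_restr)
        ultimately have "rep (x p) = rep ?v"
          using follows_unique[OF g(3)[OF \<open>x \<in> A\<close> p]] F restr_in_Field[OF F(2) lev(2)] lev(4) by blast
        then show ?thesis using F lev by (simp add: T_iff)
      qed
      then have "(x, y) \<in> tree_product omega1 P (subtree T)"
        using T.in_tree_product_iff[OF AN[OF that(1)] AN[OF that(2)] level] by blast
      then show ?thesis using A that by (auto simp: antichain_def)
    qed
    have "antichain S (g ` A)"
      using eq g(1) Field2 by (fastforce simp: antichain_def)
    then have "countable (g ` A)" using souslin_treeD(1)[OF souslin] by (simp add: ccc_def)
    moreover have "inj_on g A"
      using eq g(1) Field2 refl by (metis inj_onI)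
    ultimately show "countable A" using countable_image_inj_on by blast
  qed
qed

section \<open>Failure of freeness for one more node\<close>

text \<open>
  Comparable tuples from different levels \<open>d < e\<close> would give, in the common guide \<open>s e\<close> of the
  longer one, a label on level \<open>d\<close> with the value \<open>1\<close> at \<open>n + 1\<close> places.
\<close>

lemma not_Suc_n_free_T: "\<not> n_free (n + 1) T"
proof
  assume free: "n_free (n + 1) T"
  obtain z :: ord1 where z: "\<And>a. z \<le> a" using Least_le[of "\<lambda>_. True"] by blast
  obtain r where r: "r \<in> Field T" "lev r = z" using T.level_nonempty by blast
  obtain P where P: "P \<subseteq> T.children r" "finite P" "card P = n + 1"
    using infinite_arbitrarily_large[OF T.souslin_treeD(4)[OF souslin_T r(1)]] by blast
  let ?a = "osuc z"
  have PT: "P \<subseteq> Field T" and Pa: "\<And>p. p \<in> P \<Longrightarrow> lev p = ?a"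
    using P(1) r(2) T.Field2 by (auto simp: T.children_def)
  then have level: "P \<subseteq> {x \<in> Field T. lev x = ?a}" by blast
  have PS: "p \<in> Field S" "rep p = p" if "p \<in> P" for p using PT that by (auto simp: Field_T_iff)
  obtain p0 where p0: "p0 \<in> P" using P(3) by fastforce
  have ccc: "ccc (tree_product omega1 P (subtree T))"
    using free P PT Pa unfolding T.n_free_iff by blast
  define D where "D = {d :: ord1. ?a \<le> d}"
  \<comment> \<open>The transported copies of \<open>s\<close> have the same labels as \<open>s\<close>, so all of them follow \<open>s\<close>.\<close>
  have "\<exists>y. \<forall>p\<in>P. y p \<in> Field S \<and> lev (y p) = osuc d \<and> rep (restr (y p) ?a) = p \<and>
      move (y p) d = 1 \<and> follows s (restr (y p) d) ?a"
    if d: "d \<in> D" and s: "s \<in> Field S" "lev s = d" for d s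
  proof -
    have le: "?a \<le> d" using d by (simp add: D_def)
    have "\<exists>y. y \<in> Field S \<and> lev y = osuc d \<and> rep (restr y ?a) = p \<and>
      move y d = 1 \<and> follows s (restr y d) ?a" if p: "p \<in> P" for p
    proof -
      have sa: "(restr s ?a, s) \<in> S" "lev (restr s ?a) = lev p"
        using s le Pa[OF p] by (simp_all add: restr_below)
      let ?u = "\<psi> (restr s ?a) p s"
      have u: "(p, ?u) \<in> S" "lev ?u = d"
        using psi_above[OF sa(1) PS(1)[OF p] sa(2)] lev_psi[OF sa(1) PS(1)[OF p] sa(2)] s by auto
      have foll: "follows s ?u ?a"
        using lab_psi[OF sa(1) PS(1)[OF p] sa(2)] sa(2) Pa[OF p] u(2) s(2)
        by (intro follows_same_labels) auto
      obtain y where y: "y \<in> children ?u" "move y (lev ?u) = 1"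
        using ex_child_with_move[of ?u 1] u(1) Field2 by blast
      then have uy: "(?u, y) \<in> S" "lev y = osuc d" using u(2) by (auto simp: children_def)
      then have "restr y d = ?u" "restr y ?a = p"
        using restr_eqI u trans[OF u(1) uy(1)] Pa[OF p] by blast+
      then show ?thesis using uy y(2) u(2) foll PS(2)[OF p] Field2 by metis
    qed
    then show ?thesis by metis
  qed
  then have "\<forall>d\<in>D. \<exists>s y. s \<in> Field S \<and> lev s = d \<and> (\<forall>p\<in>P. y p \<in> Field S \<and> lev (y p) = osuc d \<and>
      rep (restr (y p) ?a) = p \<and> move (y p) d = 1 \<and> follows s (restr (y p) d) ?a)"
    using level_nonempty by metis
  then obtain s y where s: "\<And>d. d \<in> D \<Longrightarrow> s d \<in> Field S \<and> lev (s d) = d"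
    and y: "\<And>d p. d \<in> D \<Longrightarrow> p \<in> P \<Longrightarrow> y d p \<in> Field S \<and> lev (y d p) = osuc d \<and>
      rep (restr (y d p) ?a) = p \<and> move (y d p) d = 1 \<and> follows (s d) (restr (y d p) d) ?a"
    by metis
  define x where "x d = restrict (\<lambda>p. rep (y d p)) P" for d
  have xp: "x d p \<in> Field S" "rep (x d p) = x d p" "lev (x d p) = osuc d" "(p, x d p) \<in> T"
    "move (x d p) d = 1" if "d \<in> D" "p \<in> P" for d p
  proof -
    have le: "?a \<le> osuc d" using that(1) by (simp add: D_def order_trans[OF _ le_osuc])
    show "x d p \<in> Field S" "rep (x d p) = x d p" "lev (x d p) = osuc d" "move (x d p) d = 1"
      using y[OF that] that by (simp_all add: x_def move_rep)
    show "(p, x d p) \<in> T"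
      using y[OF that] that PS[OF that(2)] Pa[OF that(2)] le
      by (simp add: x_def T_iff rep_restr_rep)
  qed
  have nodes: "x d \<in> tree_product_nodes omega1 P (subtree T)" if "d \<in> D" for d
    unfolding T.tree_product_nodes_iff[OF level] using xp(3,4)[OF that] by (auto simp: x_def)
  \<comment> \<open>The tuples are compared on level \<open>d\<close>, where the longer walks are still guided by \<open>s e\<close>.\<close>
  have incomparable: "\<exists>p\<in>P. (x d p, x e p) \<notin> T" if de: "d \<in> D" "e \<in> D" "d \<noteq> e" for d e
  proof (rule ccontr)
    assume "\<not> ?thesis"
    then have T: "(x d p, x e p) \<in> T" if "p \<in> P" for p using that by blast
    then have "osuc d \<le> osuc e" using T.lev_le[OF T[OF p0]] xp(3) de p0 by simp
    then have less: "d < e" using de(3) by (metis less_osuc_iff osuc_le_iff le_less)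
    have look: "look (lab (s e) d) (rep (restr (x e p) d)) = 1" if p: "p \<in> P" for p
    proof -
      have ye: "y e p \<in> Field S" "lev (y e p) = osuc e" "follows (s e) (restr (y e p) e) ?a"
        using y de p by auto
      have oc: "osuc d \<le> osuc e" "d \<le> osuc e" "e \<le> osuc e" "d < osuc e" using less
        by (auto simp: osuc_le_iff less_osuc_iff less_imp_le intro: less_trans)
      have "rep (restr (x e p) (osuc d)) = rep (x d p)"
        using T[OF p] xp(3)[OF de(1) p] xp(2)[OF de(1) p] by (simp add: T_iff)
      then have "move (restr (x e p) (osuc d)) d = move (x d p) d"
        using rep_eq_iff[OF restr_in_Field xp(1)[OF de(1) p], of "x e p" "osuc d"]
          xp(1,3)[OF de(2) p] xp(3)[OF de(1) p] oc by simp
      then have "move (x e p) d = 1"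
        using xp(5)[OF de(1) p] xp(1,3)[OF de(2) p] oc by (simp add: move_restr)
      then have "move (y e p) d = 1" using p ye oc by (simp add: x_def move_rep)
      then have "move (restr (y e p) e) d = 1" using ye less oc by (simp add: move_restr)
      then have "look (lab (s e) d) (rep (restr (restr (y e p) e) d)) = 1"
        using ye(3) s[OF de(2)] less de(1) by (simp add: follows_def D_def)
      then have "look (lab (s e) d) (rep (restr (y e p) d)) = 1"
        using ye less oc by (simp add: restr_restr less_imp_le)
      then show ?thesis using ye p oc by (simp add: x_def rep_restr_rep)
    qed
    let ?Z = "{q. look (lab (s e) d) q \<noteq> 0}"
    have "inj_on (\<lambda>p. rep (restr (x e p) d)) P"
    proof (rule inj_onI)
      fix p q assume pq: "p \<in> P" "q \<in> P" "rep (restr (x e p) d) = rep (restr (x e q) d)"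
      have le: "d \<le> osuc e" "?a \<le> d" using less de(1)
        by (auto simp: D_def less_imp_le intro: order_trans[OF _ le_osuc])
      have "rep (restr (restr (x e p) d) ?a) = rep (restr (restr (x e q) d) ?a)"
        using rep_restr_cong[OF _ _ pq(3), of ?a] xp(1,3)[OF de(2)] pq(1,2) le
        by (simp add: restr_in_Field)
      then have "rep (restr (x e p) ?a) = rep (restr (x e q) ?a)"
        using xp(1,3)[OF de(2)] pq(1,2) le by (simp add: restr_restr)
      then show "p = q" using xp(4)[OF de(2)] pq(1,2) Pa by (simp add: T_iff)
    qed
    then have "n + 1 = card ((\<lambda>p. rep (restr (x e p) d)) ` P)" using P(3) by (simp add: card_image)
    also have "\<dots> \<le> card ?Z"
      using look card_look_nonzero by (intro card_mono) auto
    also have "\<dots> \<le> length (lab (s e) d)" using card_look_nonzero by blast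
    also have "\<dots> \<le> n"
      using lab_in_labels[of "s e" d] s[OF de(2)] less by (simp add: labels_def)
    finally show False by simp
  qed
  have "antichain (tree_product omega1 P (subtree T)) (x ` D)"
    unfolding antichain_def T.Field_tree_product[OF level]
  proof (intro conjI ballI impI)
    fix u v assume "u \<in> x ` D" "v \<in> x ` D" "u \<noteq> v"
    then obtain d e where "d \<in> D" "e \<in> D" "d \<noteq> e" "u = x d" "v = x e" by blast
    then show "(u, v) \<notin> tree_product omega1 P (subtree T)" "(v, u) \<notin> tree_product omega1 P (subtree T)"
      using incomparable T.in_tree_product_iff[OF nodes nodes level] by metis+
  qed (use nodes in blast)
  then have "countable (x ` D)" using ccc by (simp add: ccc_def)
  moreover have "inj_on x D" using xp(3) p0 by (metis inj_onI osuc_inject)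
  ultimately have "countable D" using countable_image_inj_on by blast
  moreover have "UNIV = {..<?a} \<union> D" by (auto simp: D_def)
  ultimately show False using uncountable_ord1 countable_lessThan_ord1[of ?a] by (metis countable_Un)
qed

end

theorem corollary3p5:
  fixes n :: nat
  assumes "n > 0"
    and "\<exists>S :: 'a rel. souslin_tree S \<and> strongly_homogeneous S"
  shows "\<exists>T :: 'a rel. souslin_tree T \<and> n_free n T \<and> \<not> n_free (n + 1) T"
proof -
  obtain S :: "'a rel" and \<psi> where S: "souslin_tree S" "coherent_family S \<psi>"
    using assms(2) by (auto simp: strongly_homogeneous_def)
  then obtain lev where "leveled_tree S lev"
    using leveled_tree_exists by (auto simp: souslin_tree_def)
  then interpret coherent_souslin_tree S lev \<psi> n
    using S assms(1) by (simp add: coherent_souslin_tree_def coherent_souslin_tree_axioms_def)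
  show ?thesis using souslin_T n_free_T not_Suc_n_free_T by blast
qed

end
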